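(* Let $m$ be a locally summable weight on a simplicial complex $\Sigma$. Then one has the orthogonal decomposition $$\ell^2=\ker\Delta_\Sigma\oplus\overline{R(\delta_N)}\oplus\overline{R(\partial_D)}.$$ In particular, for the restriction $\Delta_{\Sigma,k}$ of $\Delta_\Sigma$ to $\ell^2(\Sigma_k,m)$, $k\ge0$, $$H^k_{(2)}(\Sigma)\cong\ker\Delta_{\Sigma,k}.$$
   Context: Simplicial complex: $V$ is a countable set and $\hat\Sigma$ is a collection of finite subsets of $V$ closed under taking subsets. $\dim\tau=|\tau|-1$, $\hat\Sigma_k=\{\tau\in\hat\Sigma:\dim\tau=k\}$. A weight is a function $m:\hat\Sigma\to(0,\infty)$. Put $\Sigma=\hat\Sigma$ if $\sum_{v\in\hat\Sigma_0}m(v)<\infty$, and $\Sigma=\hat\Sigma\setminus\{\varnothing\}$ otherwise; $\Sigma_k=\hat\Sigma_k\cap\Sigma$. For $\tau,\sigma\in\Sigma$, $\tau\prec\sigma$ (equivalently $\sigma\succ\tau$) means $\tau\subset\sigma$ and $|\sigma\setminus\tau|=1$. All sums are over elements of $\Sigma$. The weight is locally summable if $\sum_{\sigma\succ\tau}m(\sigma)<\infty$ for all $\tau\in\Sigma$. Functions: $F=\mathbb{R}^{\Sigma}$; $F^c$ is the subspace of finitely supported functions; $F^1=\{\omega\in F:\sum_{\sigma\succ\tau}m(\sigma)|\omega(\sigma)|<\infty\text{ for all }\tau\in\Sigma\}$; $\|\omega\|^2=\sum_\Sigma m\omega^2$; $\ell^2=\ell^2(\Sigma,m)$ is the Hilbert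 space of $\omega$ with $\|\omega\|<\infty$, and $\ell^2(\Sigma_k,m)$ its subspace of functions supported on $\Sigma_k$ (zero space if $\Sigma_k=\varnothing$). Coboundary operator: a linear map $\delta:F\to F$ with $\delta\delta=0$ such that $\theta(\tau,\sigma):=\delta 1_\tau(\sigma)\in\{-1,0,1\}$, $\theta(\tau,\sigma)\neq0$ iff $\tau\prec\sigma$, and $\delta\omega(\sigma)=\sum_{\tau\prec\sigma}\omega(\tau)\theta(\tau,\sigma)$. Boundary operator: $\partial:F^1\to F$, $\partial\omega(\rho)=\frac1{m(\rho)}\sum_{\tau\succ\rho}m(\tau)\omega(\tau)\theta(\rho,\tau)$. Under local summability $\ell^2\subseteq F^1$. Operators on $\ell^2$: $\delta_N$ is the restriction of $\delta$ to $D(\delta_N)=\{\omega\in\ell^2:\delta\omega\in\ell^2\}$; $\partial_D$ is the restriction of $\partial$ to $D(\partial_D)$, the closure of $F^c$ in $\{\omega\in\ell^2:\partial\omega\in\ell^2\}$ with respect to the norm $(\|\partial\omega\|^2+\|\omega\|^2)^{1/2}$. $\Delta_\Sigma=\delta_N\partial_D+\partial_D\delta_N$ with the natural domains $D(A+B)=D(A)\cap D(B)$, $D(AB)=\{f\in D(B):Bf\in D(A)\}$. $R(A)$ is the range of $A$. $\delta_{N,k}$ is the restriction of $\delta_N$ to $D(\delta_N)\cap\ell^2(\Sigma_k,m)$. The reduced $\ell^2$-cohomology is $H^k_{(2)}(\Sigma)=\ker\delta_{N,k}/\overline{R(\delta_{N,k-1})}$. *)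

theory Defs
  imports
    "HOL-Analysis.Analysis"
    "HOL-Library.Function_Algebras"
    "HOL-Library.Set_Algebras"
begin

text \<open>
  A complex is given by its family \<open>K\<close> of all simplices, with the empty simplex (of
  dimension \<open>-1\<close>) allowed; \<open>faces K m\<close> is the possibly smaller family over which all
  sums and functions are taken, and which depends on the weight \<open>m\<close>.
\<close>

definition abstract_simplicial_complex :: "'v set \<Rightarrow> 'v set set \<Rightarrow> bool" where
  "abstract_simplicial_complex V K \<longleftrightarrow>
     countable V \<and> (\<forall>\<tau>\<in>K. finite \<tau> \<and> \<tau> \<subseteq> V) \<and> (\<forall>\<tau>\<in>K. \<forall>\<rho>. \<rho> \<subseteq> \<tau> \<longrightarrow> \<rho> \<in> K)"

definition weight :: "'v set set \<Rightarrow> ('v set \<Rightarrow> real) \<Rightarrow> bool" where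
  "weight K m \<longleftrightarrow> (\<forall>\<tau>\<in>K. 0 < m \<tau>)"

definition simplex_dim :: "'v set \<Rightarrow> int" where
  "simplex_dim \<tau> = int (card \<tau>) - 1"

definition faces :: "'v set set \<Rightarrow> ('v set \<Rightarrow> real) \<Rightarrow> 'v set set" where
  "faces K m = (if m summable_on {\<tau>\<in>K. simplex_dim \<tau> = 0} then K else K - {{}})"

definition covers :: "'v set \<Rightarrow> 'v set \<Rightarrow> bool" where
  "covers \<tau> \<sigma> \<longleftrightarrow> \<tau> \<subseteq> \<sigma> \<and> card (\<sigma> - \<tau>) = 1"

definition locally_summable :: "'v set set \<Rightarrow> ('v set \<Rightarrow> real) \<Rightarrow> bool" where
  "locally_summable K m \<longleftrightarrow>
     (\<forall>\<tau>\<in>faces K m. m summable_on {\<sigma>\<in>faces K m. covers \<tau> \<sigma>})"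

subsection \<open>Function spaces\<close>

text \<open>
  Real functions on \<open>faces K m\<close> are represented by their extension by zero to all sets;
  addition, subtraction and zero are pointwise.
\<close>

type_synonym 'v cochain = "'v set \<Rightarrow> real"

definition cochains :: "'v set set \<Rightarrow> ('v set \<Rightarrow> real) \<Rightarrow> 'v cochain set" where
  "cochains K m = {\<omega>. \<forall>\<tau>. \<tau> \<notin> faces K m \<longrightarrow> \<omega> \<tau> = 0}"

definition cochains_fin :: "'v set set \<Rightarrow> ('v set \<Rightarrow> real) \<Rightarrow> 'v cochain set" where
  "cochains_fin K m = {\<omega>\<in>cochains K m. finite {\<tau>. \<omega> \<tau> \<noteq> 0}}"

definition cochains_l1 :: "'v set set \<Rightarrow> ('v set \<Rightarrow> real) \<Rightarrow> 'v cochain set" where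
  "cochains_l1 K m = {\<omega>\<in>cochains K m.
     \<forall>\<tau>\<in>faces K m. (\<lambda>\<sigma>. m \<sigma> * \<bar>\<omega> \<sigma>\<bar>) summable_on {\<sigma>\<in>faces K m. covers \<tau> \<sigma>}}"

definition l2 :: "'v set set \<Rightarrow> ('v set \<Rightarrow> real) \<Rightarrow> 'v cochain set" where
  "l2 K m = {\<omega>\<in>cochains K m. (\<lambda>\<tau>. m \<tau> * (\<omega> \<tau>)\<^sup>2) summable_on faces K m}"

definition l2_dim :: "'v set set \<Rightarrow> ('v set \<Rightarrow> real) \<Rightarrow> int \<Rightarrow> 'v cochain set" where
  "l2_dim K m k = {\<omega>\<in>l2 K m. \<forall>\<tau>. \<omega> \<tau> \<noteq> 0 \<longrightarrow> simplex_dim \<tau> = k}"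

definition l2_inner :: "'v set set \<Rightarrow> ('v set \<Rightarrow> real) \<Rightarrow> 'v cochain \<Rightarrow> 'v cochain \<Rightarrow> real" where
  "l2_inner K m \<omega> \<eta> = (\<Sum>\<^sub>\<infinity>\<tau>\<in>faces K m. m \<tau> * \<omega> \<tau> * \<eta> \<tau>)"

definition l2_norm :: "'v set set \<Rightarrow> ('v set \<Rightarrow> real) \<Rightarrow> 'v cochain \<Rightarrow> real" where
  "l2_norm K m \<omega> = sqrt (\<Sum>\<^sub>\<infinity>\<tau>\<in>faces K m. m \<tau> * (\<omega> \<tau>)\<^sup>2)"

definition l2_closure :: "'v set set \<Rightarrow> ('v set \<Rightarrow> real) \<Rightarrow> 'v cochain set \<Rightarrow> 'v cochain set" where
  "l2_closure K m S =
     Metric_space.mtopology (l2 K m) (\<lambda>\<omega> \<eta>. l2_norm K m (\<omega> - \<eta>)) closure_of S"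

definition l2_orthogonal ::
    "'v set set \<Rightarrow> ('v set \<Rightarrow> real) \<Rightarrow> 'v cochain set \<Rightarrow> 'v cochain set \<Rightarrow> bool" where
  "l2_orthogonal K m A B \<longleftrightarrow> (\<forall>\<omega>\<in>A. \<forall>\<eta>\<in>B. l2_inner K m \<omega> \<eta> = 0)"

subsection \<open>Coboundary and boundary\<close>

definition incidence :: "('v cochain \<Rightarrow> 'v cochain) \<Rightarrow> 'v set \<Rightarrow> 'v set \<Rightarrow> real" where
  "incidence \<delta> \<tau> \<sigma> = \<delta> (indicator {\<tau>}) \<sigma>"

definition coboundary_operator ::
    "'v set set \<Rightarrow> ('v set \<Rightarrow> real) \<Rightarrow> ('v cochain \<Rightarrow> 'v cochain) \<Rightarrow> bool" where
  "coboundary_operator K m \<delta> \<longleftrightarrow>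
     (\<forall>\<omega>\<in>cochains K m. \<delta> \<omega> \<in> cochains K m) \<and>
     (\<forall>\<omega>\<in>cochains K m. \<forall>\<eta>\<in>cochains K m. \<delta> (\<omega> + \<eta>) = \<delta> \<omega> + \<delta> \<eta>) \<and>
     (\<forall>c. \<forall>\<omega>\<in>cochains K m. \<delta> (\<lambda>\<tau>. c * \<omega> \<tau>) = (\<lambda>\<tau>. c * \<delta> \<omega> \<tau>)) \<and>
     (\<forall>\<omega>\<in>cochains K m. \<delta> (\<delta> \<omega>) = 0) \<and>
     (\<forall>\<tau>\<in>faces K m. \<forall>\<sigma>\<in>faces K m.
        incidence \<delta> \<tau> \<sigma> \<in> {-1, 0, 1} \<and> (incidence \<delta> \<tau> \<sigma> \<noteq> 0 \<longleftrightarrow> covers \<tau> \<sigma>)) \<and>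
     (\<forall>\<omega>\<in>cochains K m. \<forall>\<sigma>\<in>faces K m.
        \<delta> \<omega> \<sigma> = (\<Sum>\<tau> | \<tau> \<in> faces K m \<and> covers \<tau> \<sigma>. \<omega> \<tau> * incidence \<delta> \<tau> \<sigma>))"

text \<open>Meaningful on \<open>cochains_l1 K m\<close>, where the defining sums converge absolutely.\<close>

definition bdry ::
    "'v set set \<Rightarrow> ('v set \<Rightarrow> real) \<Rightarrow> ('v cochain \<Rightarrow> 'v cochain) \<Rightarrow> 'v cochain \<Rightarrow> 'v cochain" where
  "bdry K m \<delta> \<omega> = (\<lambda>\<rho>. if \<rho> \<in> faces K m
     then (1 / m \<rho>) * (\<Sum>\<^sub>\<infinity>\<tau>\<in>{\<tau>\<in>faces K m. covers \<rho> \<tau>}. m \<tau> * \<omega> \<tau> * incidence \<delta> \<rho> \<tau>)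
     else 0)"

subsection \<open>Unbounded operators\<close>

text \<open>
  Unbounded operators are partial functions, so that \<open>dom\<close>, \<open>ran\<close> and the restriction
  \<open>|`\<close> are those of maps, and \<open>A \<circ>\<^sub>m B\<close> is the product with its natural domain.
\<close>

type_synonym 'v unbounded_op = "'v cochain \<rightharpoonup> 'v cochain"

definition op_add :: "'v unbounded_op \<Rightarrow> 'v unbounded_op \<Rightarrow> 'v unbounded_op" where
  "op_add A B = (\<lambda>\<omega>. Some (the (A \<omega>) + the (B \<omega>))) |` (dom A \<inter> dom B)"

definition op_ker :: "'v unbounded_op \<Rightarrow> 'v cochain set" where
  "op_ker A = {\<omega>. A \<omega> = Some 0}"

definition delta_N ::
    "'v set set \<Rightarrow> ('v set \<Rightarrow> real) \<Rightarrow> ('v cochain \<Rightarrow> 'v cochain) \<Rightarrow> 'v unbounded_op" where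
  "delta_N K m \<delta> = (\<lambda>\<omega>. Some (\<delta> \<omega>)) |` {\<omega>\<in>l2 K m. \<delta> \<omega> \<in> l2 K m}"

definition bdry_max_dom ::
    "'v set set \<Rightarrow> ('v set \<Rightarrow> real) \<Rightarrow> ('v cochain \<Rightarrow> 'v cochain) \<Rightarrow> 'v cochain set" where
  "bdry_max_dom K m \<delta> = {\<omega>\<in>l2 K m \<inter> cochains_l1 K m. bdry K m \<delta> \<omega> \<in> l2 K m}"

definition bdry_graph_norm ::
    "'v set set \<Rightarrow> ('v set \<Rightarrow> real) \<Rightarrow> ('v cochain \<Rightarrow> 'v cochain) \<Rightarrow> 'v cochain \<Rightarrow> real" where
  "bdry_graph_norm K m \<delta> \<omega> = sqrt ((l2_norm K m (bdry K m \<delta> \<omega>))\<^sup>2 + (l2_norm K m \<omega>)\<^sup>2)"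

definition bdry_D ::
    "'v set set \<Rightarrow> ('v set \<Rightarrow> real) \<Rightarrow> ('v cochain \<Rightarrow> 'v cochain) \<Rightarrow> 'v unbounded_op" where
  "bdry_D K m \<delta> = (\<lambda>\<omega>. Some (bdry K m \<delta> \<omega>)) |`
     (Metric_space.mtopology (bdry_max_dom K m \<delta>) (\<lambda>\<omega> \<eta>. bdry_graph_norm K m \<delta> (\<omega> - \<eta>))
        closure_of cochains_fin K m)"

definition Laplacian ::
    "'v set set \<Rightarrow> ('v set \<Rightarrow> real) \<Rightarrow> ('v cochain \<Rightarrow> 'v cochain) \<Rightarrow> 'v unbounded_op" where
  "Laplacian K m \<delta> =
     op_add (delta_N K m \<delta> \<circ>\<^sub>m bdry_D K m \<delta>) (bdry_D K m \<delta> \<circ>\<^sub>m delta_N K m \<delta>)"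

definition delta_N_dim ::
    "'v set set \<Rightarrow> ('v set \<Rightarrow> real) \<Rightarrow> ('v cochain \<Rightarrow> 'v cochain) \<Rightarrow> int \<Rightarrow> 'v unbounded_op" where
  "delta_N_dim K m \<delta> k = delta_N K m \<delta> |` l2_dim K m k"

definition Laplacian_dim ::
    "'v set set \<Rightarrow> ('v set \<Rightarrow> real) \<Rightarrow> ('v cochain \<Rightarrow> 'v cochain) \<Rightarrow> int \<Rightarrow> 'v unbounded_op" where
  "Laplacian_dim K m \<delta> k = Laplacian K m \<delta> |` l2_dim K m k"

subsection \<open>Reduced cohomology\<close>

text \<open>
  Elements of a quotient by a subspace \<open>B\<close> are the cosets \<open>\<omega> +o B\<close>, added by the
  Minkowski sum of sets. In \<open>quot_scale\<close> the summand \<open>B\<close> matters only for the scalar zero,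
  where the image of a coset is \<open>{0}\<close> rather than \<open>B\<close>.
\<close>

definition reduced_bounds ::
    "'v set set \<Rightarrow> ('v set \<Rightarrow> real) \<Rightarrow> ('v cochain \<Rightarrow> 'v cochain) \<Rightarrow> int \<Rightarrow> 'v cochain set" where
  "reduced_bounds K m \<delta> k = l2_closure K m (ran (delta_N_dim K m \<delta> (k - 1)))"

definition reduced_cohomology ::
    "'v set set \<Rightarrow> ('v set \<Rightarrow> real) \<Rightarrow> ('v cochain \<Rightarrow> 'v cochain) \<Rightarrow> int \<Rightarrow> 'v cochain set set" where
  "reduced_cohomology K m \<delta> k =
     (\<lambda>\<omega>. \<omega> +o reduced_bounds K m \<delta> k) ` op_ker (delta_N_dim K m \<delta> k)"

definition quot_scale :: "'v cochain set \<Rightarrow> real \<Rightarrow> 'v cochain set \<Rightarrow> 'v cochain set" where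
  "quot_scale B c X = (\<lambda>\<omega> \<tau>. c * \<omega> \<tau>) ` X + B"

definition quot_norm :: "'v set set \<Rightarrow> ('v set \<Rightarrow> real) \<Rightarrow> 'v cochain set \<Rightarrow> real" where
  "quot_norm K m X = (INF \<omega>\<in>X. l2_norm K m \<omega>)"

text \<open>
  Isomorphism of Hilbert spaces: a linear bijection that is isometric for the quotient norm.
\<close>

definition cohomology_iso ::
    "'v set set \<Rightarrow> ('v set \<Rightarrow> real) \<Rightarrow> ('v cochain \<Rightarrow> 'v cochain) \<Rightarrow> int \<Rightarrow> 'v cochain set \<Rightarrow> bool" where
  "cohomology_iso K m \<delta> k S \<longleftrightarrow>
     (\<exists>\<Phi>. bij_betw \<Phi> (reduced_cohomology K m \<delta> k) S \<and>
        (\<forall>X\<in>reduced_cohomology K m \<delta> k. \<forall>Y\<in>reduced_cohomology K m \<delta> k.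
           \<Phi> (X + Y) = \<Phi> X + \<Phi> Y) \<and>
        (\<forall>c. \<forall>X\<in>reduced_cohomology K m \<delta> k.
           \<Phi> (quot_scale (reduced_bounds K m \<delta> k) c X) = (\<lambda>\<tau>. c * \<Phi> X \<tau>)) \<and>
        (\<forall>X\<in>reduced_cohomology K m \<delta> k. l2_norm K m (\<Phi> X) = quot_norm K m X))"

end

theory Submission
  imports Defs
begin

text \<open>
  By local summability every \<open>\<delta> 1\<^sub>\<rho>\<close> is square-summable, and \<open>\<delta>\<^sub>N\<close> is the Hilbert space adjoint of
  \<open>\<partial>\<close> on finitely supported cochains, whose closure is \<open>\<partial>\<^sub>D\<close>. Hence \<open>ker \<delta>\<^sub>N\<close> and \<open>ker \<partial>\<^sub>D\<close> are
  the orthogonal complements of \<open>R(\<partial>\<^sub>D)\<close> and \<open>R(\<delta>\<^sub>N)\<close>. These ranges are orthogonal because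
  \<open>\<delta> \<delta> = 0\<close>, and pairing \<open>\<Delta> \<omega> = 0\<close> with \<open>\<omega>\<close> shows \<open>ker \<Delta> = ker \<delta>\<^sub>N \<inter> ker \<partial>\<^sub>D\<close>. For the
  cohomology, truncation to one dimension intertwines with \<open>\<delta>\<close>, so a cocycle of dimension \<open>k\<close>
  orthogonal to \<open>R(\<delta>\<^bsub>N,k-1\<^esub>)\<close> is orthogonal to all of \<open>R(\<delta>\<^sub>N)\<close> and therefore harmonic; the
  harmonic representative of a class is its element of least norm.

  Orthogonal projections are taken in an abstract space of square-summable functions, into which
  \<open>\<omega> \<mapsto> \<surd>m \<omega>\<close> embeds the weighted space isometrically.
\<close>

subsection \<open>Square-summable functions and orthogonal projections\<close>

lemma summable_mult_squares:
  fixes f g :: "'a \<Rightarrow> real"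
  assumes "(\<lambda>i. (f i)\<^sup>2) summable_on A" and "(\<lambda>i. (g i)\<^sup>2) summable_on A"
  shows "(\<lambda>i. f i * g i) summable_on A"
proof -
  have "(\<lambda>i. (f i)\<^sup>2 + (g i)\<^sup>2) summable_on A"
    using assms by (rule summable_on_add)
  moreover have "norm (f i * g i) \<le> (f i)\<^sup>2 + (g i)\<^sup>2" for i
  proof -
    have "2 * (\<bar>f i\<bar> * \<bar>g i\<bar>) \<le> (f i)\<^sup>2 + (g i)\<^sup>2"
      using sum_squares_bound[of "\<bar>f i\<bar>" "\<bar>g i\<bar>"] by (simp add: mult.assoc)
    moreover have "0 \<le> \<bar>f i\<bar> * \<bar>g i\<bar>" by simp
    ultimately show ?thesis unfolding real_norm_def abs_mult by linarith
  qed
  ultimately have "(\<lambda>i. norm (f i * g i)) summable_on A"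
    by (rule summable_on_comparison_test) auto
  then show ?thesis by (rule abs_summable_summable)
qed

lemma summable_add_squares:
  fixes f g :: "'a \<Rightarrow> real"
  assumes "(\<lambda>i. (f i)\<^sup>2) summable_on A" and "(\<lambda>i. (g i)\<^sup>2) summable_on A"
  shows "(\<lambda>i. (f i + g i)\<^sup>2) summable_on A"
proof -
  have "(\<lambda>i. f i * g i) summable_on A"
    using assms by (rule summable_mult_squares)
  then have "(\<lambda>i. (f i)\<^sup>2 + (g i)\<^sup>2 + 2 * (f i * g i)) summable_on A"
    by (intro summable_on_add assms summable_on_cmult_right)
  then show ?thesis
    by (simp add: power2_sum mult.assoc)
qed

text \<open>A type and not a carrier set, so that \<open>closure\<close>, limits and products come
  from the type classes \<open>real_inner\<close> and \<open>complete_space\<close>.\<close>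

typedef 'a ell2 = "{f :: 'a \<Rightarrow> real. (\<lambda>i. (f i)\<^sup>2) summable_on UNIV}"
  morphisms ell2_apply Abs_ell2
  by (rule exI[of _ "\<lambda>_. 0"]) simp

setup_lifting type_definition_ell2

lemma ell2_square_summable: "(\<lambda>i. (ell2_apply x i)\<^sup>2) summable_on UNIV"
  using ell2_apply[of x] by simp

lemma ell2_mult_summable: "(\<lambda>i. ell2_apply x i * ell2_apply y i) summable_on UNIV"
  by (rule summable_mult_squares[OF ell2_square_summable ell2_square_summable])

instantiation ell2 :: (type) real_inner
begin

lift_definition zero_ell2 :: "'a ell2" is "\<lambda>_. 0" by simp
lift_definition plus_ell2 :: "'a ell2 \<Rightarrow> 'a ell2 \<Rightarrow> 'a ell2" is "\<lambda>f g i. f i + g i"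
  by (rule summable_add_squares)
lift_definition uminus_ell2 :: "'a ell2 \<Rightarrow> 'a ell2" is "\<lambda>f i. - f i" by simp
lift_definition minus_ell2 :: "'a ell2 \<Rightarrow> 'a ell2 \<Rightarrow> 'a ell2" is "\<lambda>f g i. f i - g i"
  using summable_add_squares[where g = "\<lambda>i. - g i" for g] by fastforce
lift_definition scaleR_ell2 :: "real \<Rightarrow> 'a ell2 \<Rightarrow> 'a ell2" is "\<lambda>c f i. c * f i"
  by (simp add: power_mult_distrib summable_on_cmult_right)
lift_definition inner_ell2 :: "'a ell2 \<Rightarrow> 'a ell2 \<Rightarrow> real" is "\<lambda>f g. \<Sum>\<^sub>\<infinity>i. f i * g i" .

definition norm_ell2 :: "'a ell2 \<Rightarrow> real" where "norm_ell2 x = sqrt (inner x x)"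
definition sgn_ell2 :: "'a ell2 \<Rightarrow> 'a ell2" where "sgn_ell2 x = inverse (norm x) *\<^sub>R x"
definition dist_ell2 :: "'a ell2 \<Rightarrow> 'a ell2 \<Rightarrow> real" where "dist_ell2 x y = norm (x - y)"
definition uniformity_ell2 :: "('a ell2 \<times> 'a ell2) filter"
  where "uniformity_ell2 = (INF e\<in>{0 <..}. principal {(x, y). dist x y < e})"
definition open_ell2 :: "'a ell2 set \<Rightarrow> bool"
  where "open_ell2 S = (\<forall>x\<in>S. \<forall>\<^sub>F (x', y) in uniformity. x' = x \<longrightarrow> y \<in> S)"

instance
proof
  fix x y z :: "'a ell2" and r s :: real
  show "x + y + z = x + (y + z)" "x + y = y + x" "0 + x = x" "- x + x = 0" "x - y = x + - y"
    by (transfer; simp add: fun_eq_iff)+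
  show "r *\<^sub>R (x + y) = r *\<^sub>R x + r *\<^sub>R y" "(r + s) *\<^sub>R x = r *\<^sub>R x + s *\<^sub>R x"
    "r *\<^sub>R s *\<^sub>R x = (r * s) *\<^sub>R x" "1 *\<^sub>R x = x"
    by (transfer; simp add: fun_eq_iff algebra_simps)+
  show "inner x y = inner y x"
    by transfer (simp add: mult.commute)
  show "inner (x + y) z = inner x z + inner y z"
    using infsum_add[OF ell2_mult_summable[of x z] ell2_mult_summable[of y z]]
    by (simp add: inner_ell2.rep_eq plus_ell2.rep_eq algebra_simps)
  show "inner (r *\<^sub>R x) y = r * inner x y"
    by transfer (simp add: mult.assoc infsum_cmult_right')
  show "0 \<le> inner x x"
    by transfer (simp add: infsum_nonneg)
  show "inner x x = 0 \<longleftrightarrow> x = 0"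
  proof
    assume "inner x x = 0"
    then have "ell2_apply x i * ell2_apply x i = 0" for i
      using nonneg_infsum_le_0D[OF _ ell2_mult_summable, of x x i]
      by (simp add: inner_ell2.rep_eq)
    then show "x = 0"
      by (simp add: ell2_apply_inject[symmetric] zero_ell2.rep_eq fun_eq_iff)
  qed (simp add: inner_ell2.rep_eq zero_ell2.rep_eq)
qed (rule norm_ell2_def sgn_ell2_def dist_ell2_def uniformity_ell2_def open_ell2_def)+

end

lemma norm_ell2_power2: "(norm x)\<^sup>2 = (\<Sum>\<^sub>\<infinity>i. (ell2_apply x i)\<^sup>2)" for x :: "'a ell2"
  unfolding power2_norm_eq_inner inner_ell2.rep_eq by (simp add: power2_eq_square)

lemma sum_ell2_apply_le:
  fixes x :: "'a ell2"
  assumes "finite F"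
  shows "(\<Sum>i\<in>F. (ell2_apply x i)\<^sup>2) \<le> (norm x)\<^sup>2"
  unfolding norm_ell2_power2
  by (rule finite_sum_le_infsum) (use assms ell2_square_summable in auto)

lemma abs_ell2_apply_le: "\<bar>ell2_apply x i\<bar> \<le> norm x" for x :: "'a ell2"
  using sum_ell2_apply_le[of "{i}" x] by (simp add: abs_le_square_iff[symmetric])

text \<open>Coordinates are 1-Lipschitz, so a Cauchy sequence converges pointwise; the Cauchy bounds
  hold on every finite partial sum, survive the limit there, and so give convergence in
  norm.\<close>

instance ell2 :: (type) complete_space
proof
  fix X :: "nat \<Rightarrow> 'a ell2"
  assume X: "Cauchy X"
  have "Cauchy (\<lambda>n. ell2_apply (X n) i)" for i
  proof (rule metric_CauchyI)
    fix e :: real assume "0 < e"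
    then obtain N where N: "\<And>p q. p \<ge> N \<Longrightarrow> q \<ge> N \<Longrightarrow> dist (X p) (X q) < e"
      using X by (meson metric_CauchyD)
    have "dist (ell2_apply (X p) i) (ell2_apply (X q) i) \<le> dist (X p) (X q)" for p q
      using abs_ell2_apply_le[of "X p - X q" i]
      by (simp add: minus_ell2.rep_eq dist_norm)
    with N show "\<exists>N. \<forall>p\<ge>N. \<forall>q\<ge>N. dist (ell2_apply (X p) i) (ell2_apply (X q) i) < e"
      by (meson le_less_trans)
  qed
  then have "\<exists>l. (\<lambda>n. ell2_apply (X n) i) \<longlonglongrightarrow> l" for i
    by (simp add: Cauchy_convergent_iff convergent_def)
  then obtain l where l: "\<And>i. (\<lambda>n. ell2_apply (X n) i) \<longlonglongrightarrow> l i"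
    by metis
  \<comment> \<open>Only finite sums are compared, so the limit in \<open>q\<close> may be taken
    term by term; the resulting bound does not depend on \<open>F\<close>.\<close>
  have bound: "(\<Sum>i\<in>F. (ell2_apply (X p) i - l i)\<^sup>2) \<le> e\<^sup>2"
    if "finite F" "0 < e" and N: "\<And>q. q \<ge> N \<Longrightarrow> dist (X p) (X q) \<le> e" for F p e N
  proof (rule LIMSEQ_le_const2)
    show "(\<lambda>q. \<Sum>i\<in>F. (ell2_apply (X p) i - ell2_apply (X q) i)\<^sup>2)
            \<longlonglongrightarrow> (\<Sum>i\<in>F. (ell2_apply (X p) i - l i)\<^sup>2)"
      by (intro tendsto_intros l)
    have "(\<Sum>i\<in>F. (ell2_apply (X p) i - ell2_apply (X q) i)\<^sup>2) \<le> e\<^sup>2" if "q \<ge> N" for q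
    proof -
      have "(\<Sum>i\<in>F. (ell2_apply (X p) i - ell2_apply (X q) i)\<^sup>2) \<le> (norm (X p - X q))\<^sup>2"
        using sum_ell2_apply_le[OF \<open>finite F\<close>, of "X p - X q"] by (simp add: minus_ell2.rep_eq)
      also have "\<dots> \<le> e\<^sup>2"
        using N[OF that] by (simp add: dist_norm power_mono)
      finally show ?thesis .
    qed
    then show "\<exists>N. \<forall>q\<ge>N. (\<Sum>i\<in>F. (ell2_apply (X p) i - ell2_apply (X q) i)\<^sup>2) \<le> e\<^sup>2"
      by blast
  qed
  have summable: "(\<lambda>i. (ell2_apply (X p) i - l i)\<^sup>2) summable_on UNIV"
    if "0 < e" "\<And>q. q \<ge> N \<Longrightarrow> dist (X p) (X q) \<le> e" for p e N
    by (rule nonneg_bdd_above_summable_on) (auto intro!: bdd_aboveI2[where M = "e\<^sup>2"] bound that)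
  obtain N where N: "\<And>q. q \<ge> N \<Longrightarrow> dist (X N) (X q) < 1"
    using metric_CauchyD[OF X, of 1] by auto
  \<comment> \<open>Coordinatewise, \<open>l\<close> is \<open>X N\<close> minus the difference
    \<open>X N - l\<close>, hence a sum of two square-summable functions.\<close>
  have "(\<lambda>i. (ell2_apply (X N) i + - (ell2_apply (X N) i - l i))\<^sup>2) summable_on UNIV"
    by (intro summable_add_squares ell2_square_summable)
      (use N summable[of 1 N N] in \<open>force simp: less_imp_le power2_commute\<close>)
  then have L: "ell2_apply (Abs_ell2 l) = l"
    by (simp add: Abs_ell2_inverse)
  have "X \<longlonglongrightarrow> Abs_ell2 l"
  proof (rule metric_LIMSEQ_I)
    fix r :: real assume "0 < r"
    \<comment> \<open>Half of \<open>r\<close>, because passing to the limit in \<open>q\<close>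
      weakens \<open><\<close> to \<open>\<le>\<close>.\<close>
    then obtain N where N: "\<And>p q. p \<ge> N \<Longrightarrow> q \<ge> N \<Longrightarrow> dist (X p) (X q) < r / 2"
      using metric_CauchyD[OF X, of "r / 2"] by auto
    have "dist (X p) (Abs_ell2 l) < r" if "p \<ge> N" for p
    proof -
      have le: "\<And>q. q \<ge> N \<Longrightarrow> dist (X p) (X q) \<le> r / 2"
        using N that by (simp add: less_imp_le)
      have "(norm (X p - Abs_ell2 l))\<^sup>2 \<le> (r / 2)\<^sup>2"
        unfolding norm_ell2_power2 minus_ell2.rep_eq L
        using \<open>0 < r\<close> le by (intro infsum_le_finite_sums summable[of "r / 2" N] bound[of _ "r / 2" N]) auto
      then have "norm (X p - Abs_ell2 l) \<le> r / 2"
        using \<open>0 < r\<close> by (simp add: power2_le_iff_abs_le)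
      with \<open>0 < r\<close> show ?thesis by (simp add: dist_norm)
    qed
    then show "\<exists>N. \<forall>p\<ge>N. dist (X p) (Abs_ell2 l) < r" by blast
  qed
  then show "convergent X" by (auto simp: convergent_def)
qed

text \<open>
  A minimising sequence is Cauchy by the parallelogram law; minimality of its limit along
  lines through it gives orthogonality.
\<close>

lemma orthogonal_projection_exists:
  fixes S :: "'a::{real_inner,complete_space} set"
  assumes "subspace S"
  shows "\<exists>p q. p \<in> closure S \<and> x = p + q \<and> (\<forall>s\<in>S. inner q s = 0)"
proof -
  define d where "d = (INF s\<in>S. (norm (x - s))\<^sup>2)"
  have S0: "0 \<in> S" using assms by (rule subspace_0)
  have bdd: "bdd_below ((\<lambda>s. (norm (x - s))\<^sup>2) ` S)"
    by (rule bdd_belowI2[of _ 0]) simp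
  have d_le: "d \<le> (norm (x - s))\<^sup>2" if "s \<in> S" for s
    unfolding d_def by (rule cINF_lower[OF bdd that])
  have "\<exists>s\<in>S. (norm (x - s))\<^sup>2 < d + 1 / real (Suc n)" for n
    using cINF_less_iff[OF _ bdd, of "d + 1 / real (Suc n)"] S0 by (auto simp: d_def)
  then obtain u where uS: "\<And>n. u n \<in> S" and u: "\<And>n. (norm (x - u n))\<^sup>2 < d + 1 / real (Suc n)"
    by metis
  have close: "(norm (u i - u j))\<^sup>2 \<le> 4 / real (Suc N)" if "i \<ge> N" "j \<ge> N" for i j N
  proof -
    have "(1/2) *\<^sub>R (u i + u j) \<in> S"
      using assms uS by (simp add: subspace_add subspace_scale)
    then have mid: "d \<le> (norm (x - (1/2) *\<^sub>R (u i + u j)))\<^sup>2" by (rule d_le)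
    \<comment> \<open>Parallelogram law: the midpoint term cancels \<open>4 * d\<close>, and the two
      excesses of at most \<open>1 / real (Suc N)\<close>, each doubled, leave the constant
      4.\<close>
    have "(norm (u i - u j))\<^sup>2 = 2 * (norm (x - u i))\<^sup>2 + 2 * (norm (x - u j))\<^sup>2
            - 4 * (norm (x - (1/2) *\<^sub>R (u i + u j)))\<^sup>2"
      by (simp add: power2_norm_eq_inner inner_diff_left inner_diff_right inner_add_left
          inner_add_right inner_commute algebra_simps)
    moreover have "1 / real (Suc i) \<le> 1 / real (Suc N)" "1 / real (Suc j) \<le> 1 / real (Suc N)"
      using that by (simp_all add: frac_le)
    ultimately show ?thesis using mid u[of i] u[of j] by simp
  qed
  have "Cauchy u"
  proof (rule metric_CauchyI)
    fix e :: real assume "0 < e"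
    then obtain N where N: "4 / e\<^sup>2 < real (Suc N)"
      by (metis reals_Archimedean2 less_trans lessI of_nat_less_iff)
    then have "4 / real (Suc N) < e\<^sup>2"
      using \<open>0 < e\<close> by (simp add: field_simps)
    then have "dist (u i) (u j) < e" if "i \<ge> N" "j \<ge> N" for i j
      using close[OF that] \<open>0 < e\<close> by (simp add: dist_norm power2_less_imp_less)
    then show "\<exists>M. \<forall>i\<ge>M. \<forall>j\<ge>M. dist (u i) (u j) < e" by blast
  qed
  then obtain p where p: "u \<longlonglongrightarrow> p"
    by (auto simp: Cauchy_convergent_iff convergent_def)
  have pS: "p \<in> closure S"
    using p uS closure_sequential by blast
  have lim: "(\<lambda>n. (norm (x - u n))\<^sup>2) \<longlonglongrightarrow> (norm (x - p))\<^sup>2"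
    by (intro tendsto_intros p)
  have "(\<lambda>n. d + 1 / real (Suc n)) \<longlonglongrightarrow> d + 0"
    by (intro tendsto_intros LIMSEQ_Suc lim_1_over_n)
  then have min: "(norm (x - p))\<^sup>2 \<le> d"
    using LIMSEQ_le[OF lim, of _ d] u by (auto intro: less_imp_le)
  have "inner (x - p) s = 0" if "s \<in> S" for s
  proof -
    \<comment> \<open>\<open>p\<close> lies only in the closure of \<open>S\<close>; the competitors
      \<open>u n + t *\<^sub>R s\<close> lie in \<open>S\<close>, and the lower bound
      \<open>d\<close> passes to their limit.\<close>
    have "d \<le> (norm (x - p - t *\<^sub>R s))\<^sup>2" for t
    proof (rule LIMSEQ_le_const)
      show "(\<lambda>n. (norm (x - (u n + t *\<^sub>R s)))\<^sup>2) \<longlonglongrightarrow> (norm (x - p - t *\<^sub>R s))\<^sup>2"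
        unfolding diff_diff_add by (intro tendsto_intros p)
      show "\<exists>N. \<forall>n\<ge>N. d \<le> (norm (x - (u n + t *\<^sub>R s)))\<^sup>2"
        using assms uS that by (intro exI allI impI d_le) (simp add: subspace_add subspace_scale)
    qed
    then have "(norm (x - p))\<^sup>2 \<le> (norm (x - p - t *\<^sub>R s))\<^sup>2" for t
      using min order_trans by blast
    then have quad: "2 * t * inner (x - p) s \<le> t\<^sup>2 * inner s s" for t
    proof -
      have "(norm (y - t *\<^sub>R s))\<^sup>2 = (norm y)\<^sup>2 - 2 * t * inner y s + t\<^sup>2 * inner s s" for y
        unfolding power2_norm_eq_inner
        by (simp add: inner_diff_left inner_diff_right inner_commute
            power2_eq_square algebra_simps)
      with \<open>(norm (x - p))\<^sup>2 \<le> (norm (x - p - t *\<^sub>R s))\<^sup>2\<close> show ?thesis by simp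
    qed
    show ?thesis
    proof (cases "s = 0")
      case False
      then have pos: "0 < inner s s" by simp
      \<comment> \<open>This value of \<open>t\<close> maximises the difference of the two sides of
        \<open>quad\<close>; the outcome has the form \<open>2 * c \<le> c\<close> with
        \<open>c\<close> non-negative, which forces \<open>c\<close> to vanish.\<close>
      have "2 * (inner (x - p) s)\<^sup>2 / inner s s \<le> (inner (x - p) s)\<^sup>2 / inner s s"
        using quad[of "inner (x - p) s / inner s s"] pos
        by (simp add: power2_eq_square field_simps)
      then show ?thesis using pos by (simp add: divide_le_cancel)
    qed simp
  qed
  with pS show ?thesis by (intro exI[of _ p] exI[of _ "x - p"]) simp
qed

subsection \<open>Isometric embedding of the weighted space\<close>

text \<open>The closures in question live in the topology of a metric on a set of functions; an
  isometry into a metric space type turns them into \<open>closure\<close>. Non-negativity and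
  symmetry are assumed everywhere because \<open>Metric_space\<close> asks for them off the carrier
  too.\<close>

lemma metric_closure_of_isometric:
  fixes G :: "'a \<Rightarrow> 'b::metric_space" and d :: "'a \<Rightarrow> 'a \<Rightarrow> real"
  assumes nonneg: "\<And>x y. 0 \<le> d x y" and commute: "\<And>x y. d x y = d y x"
    and inj: "inj_on G M" and isom: "\<And>x y. x \<in> M \<Longrightarrow> y \<in> M \<Longrightarrow> d x y = dist (G x) (G y)"
    and "S \<subseteq> M"
  shows "Metric_space.mtopology M d closure_of S = {x \<in> M. G x \<in> closure (G ` S)}"
proof -
  interpret Metric_space M d
  proof
    show "0 \<le> d x y" "d x y = d y x" for x y by (fact nonneg, fact commute)
    show "d x y = 0 \<longleftrightarrow> x = y" if "x \<in> M" "y \<in> M" for x y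
      using that inj by (auto simp: isom dest: inj_onD)
    show "d x z \<le> d x y + d y z" if "x \<in> M" "y \<in> M" "z \<in> M" for x y z
      using that by (simp add: isom dist_triangle)
  qed
  have "(\<forall>r>0. \<exists>y\<in>S. y \<in> mball x r) \<longleftrightarrow> G x \<in> closure (G ` S)" if "x \<in> M" for x
  proof -
    have "y \<in> mball x r \<longleftrightarrow> dist (G y) (G x) < r" if "y \<in> S" for y r
      using that \<open>x \<in> M\<close> \<open>S \<subseteq> M\<close> by (simp add: in_mball isom dist_commute subset_iff)
    then have "(\<exists>y\<in>S. y \<in> mball x r) \<longleftrightarrow> (\<exists>z\<in>G ` S. dist z (G x) < r)" for r by simp
    then show ?thesis by (simp add: closure_approachable)
  qed
  then show ?thesis unfolding metric_closure_of by auto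
qed

lemma bounded_linear_ell2_apply: "bounded_linear (\<lambda>x. ell2_apply x i)"
  by (rule bounded_linear_intro[where K = 1])
    (simp_all add: plus_ell2.rep_eq scaleR_ell2.rep_eq abs_ell2_apply_le)

lemmas continuous_on_ell2_apply [continuous_intros] =
  bounded_linear.continuous_on[OF bounded_linear_ell2_apply]

lemma subspace_closure:
  fixes S :: "'a::real_normed_vector set"
  assumes "subspace S"
  shows "subspace (closure S)"
  unfolding subspace_def
proof (intro conjI ballI allI)
  show "0 \<in> closure S"
    using subspace_0[OF assms] closure_subset by blast
  fix x assume "x \<in> closure S"
  then obtain u where u: "\<And>n. u n \<in> S" "u \<longlonglongrightarrow> x"
    unfolding closure_sequential by metis
  show "c *\<^sub>R x \<in> closure S" for c
    unfolding closure_sequential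
    by (intro exI[of _ "\<lambda>n. c *\<^sub>R u n"] conjI allI subspace_scale[OF assms] u tendsto_intros)
  fix y assume "y \<in> closure S"
  then obtain w where w: "\<And>n. w n \<in> S" "w \<longlonglongrightarrow> y"
    unfolding closure_sequential by metis
  show "x + y \<in> closure S"
    unfolding closure_sequential
    by (intro exI[of _ "\<lambda>n. u n + w n"] conjI allI subspace_add[OF assms] u w tendsto_intros)
qed

locale weighted_complex =
  fixes V :: "'v set" and K :: "'v set set" and m :: "'v set \<Rightarrow> real"
    and \<delta> :: "'v cochain \<Rightarrow> 'v cochain"
  assumes complex: "abstract_simplicial_complex V K"
    and weight: "weight K m"
    and locally_summable: "locally_summable K m"
    and coboundary: "coboundary_operator K m \<delta>"
begin

abbreviation X where "X \<equiv> faces K m"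
abbreviation L where "L \<equiv> l2 K m"
abbreviation ip where "ip \<equiv> l2_inner K m"
abbreviation bd where "bd \<equiv> bdry K m \<delta>"
abbreviation Fc where "Fc \<equiv> cochains_fin K m"

lemma faces_subset: "X \<subseteq> K" by (auto simp: faces_def)

lemma finite_face: "\<tau> \<in> X \<Longrightarrow> finite \<tau>"
  using complex faces_subset unfolding abstract_simplicial_complex_def by blast

lemma weight_pos: "\<tau> \<in> X \<Longrightarrow> 0 < m \<tau>"
  using weight faces_subset by (auto simp: weight_def)

lemma finite_facets: "\<sigma> \<in> X \<Longrightarrow> finite {\<tau> \<in> X. covers \<tau> \<sigma>}"
  by (rule finite_subset[of _ "Pow \<sigma>"]) (auto simp: covers_def finite_face)

lemma covers_dim: "\<sigma> \<in> X \<Longrightarrow> covers \<tau> \<sigma> \<Longrightarrow> simplex_dim \<sigma> = simplex_dim \<tau> + 1"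
  using card_Diff_subset[of \<tau> \<sigma>] card_mono[of \<sigma> \<tau>] finite_subset[of \<tau> \<sigma>] finite_face[of \<sigma>]
  by (auto simp: covers_def simplex_dim_def)

lemma cochain_zero: "\<omega> \<in> cochains K m \<Longrightarrow> \<tau> \<notin> X \<Longrightarrow> \<omega> \<tau> = 0"
  by (simp add: cochains_def)

lemma cochain_eqI:
  assumes "\<omega> \<in> cochains K m" "\<eta> \<in> cochains K m" "\<And>\<tau>. \<tau> \<in> X \<Longrightarrow> \<omega> \<tau> = \<eta> \<tau>"
  shows "\<omega> = \<eta>"
proof
  show "\<omega> \<tau> = \<eta> \<tau>" for \<tau>
    using assms by (cases "\<tau> \<in> X") (simp_all add: cochain_zero)
qed

lemma l2_cochain: "\<omega> \<in> L \<Longrightarrow> \<omega> \<in> cochains K m"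
  by (simp add: l2_def)

text \<open>Cochains vanish off \<open>X\<close>, so the values of \<open>m\<close> there do not
  matter; on \<open>X\<close> the weight is positive and \<open>sqrt (m \<tau>)\<close> squares to
  \<open>m \<tau>\<close>.\<close>

lemma l2_iff:
  "\<omega> \<in> L \<longleftrightarrow> \<omega> \<in> cochains K m \<and> (\<lambda>\<tau>. (sqrt (m \<tau>) * \<omega> \<tau>)\<^sup>2) summable_on UNIV"
proof -
  have "(\<lambda>\<tau>. (sqrt (m \<tau>) * \<omega> \<tau>)\<^sup>2) summable_on UNIV \<longleftrightarrow> (\<lambda>\<tau>. m \<tau> * (\<omega> \<tau>)\<^sup>2) summable_on X"
    if "\<omega> \<in> cochains K m"
    by (rule summable_on_cong_neutral)
      (use that in \<open>auto simp: cochain_zero power_mult_distrib weight_pos less_imp_le\<close>)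
  then show ?thesis by (auto simp: l2_def)
qed

text \<open>Meaningful on \<open>L\<close> only, where \<open>l2_iff\<close> makes the argument of
  \<open>Abs_ell2\<close> square-summable.\<close>

definition emb :: "'v cochain \<Rightarrow> 'v set ell2" where
  "emb \<omega> = Abs_ell2 (\<lambda>\<tau>. sqrt (m \<tau>) * \<omega> \<tau>)"

lemma emb_apply: "\<omega> \<in> L \<Longrightarrow> ell2_apply (emb \<omega>) \<tau> = sqrt (m \<tau>) * \<omega> \<tau>"
  by (simp add: emb_def Abs_ell2_inverse l2_iff)

lemma l2_zero: "0 \<in> L"
  by (simp add: l2_iff cochains_def)

lemma l2_add: "\<omega> \<in> L \<Longrightarrow> \<eta> \<in> L \<Longrightarrow> \<omega> + \<eta> \<in> L"
  using summable_add_squares[of "\<lambda>\<tau>. sqrt (m \<tau>) * \<omega> \<tau>" UNIV "\<lambda>\<tau>. sqrt (m \<tau>) * \<eta> \<tau>"]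
  by (auto simp: l2_iff cochains_def distrib_left)

lemma l2_scale: "\<omega> \<in> L \<Longrightarrow> (\<lambda>\<tau>. c * \<omega> \<tau>) \<in> L"
  by (auto simp: l2_iff cochains_def power_mult_distrib mult.left_commute intro: summable_on_cmult_right)

lemma l2_uminus: "\<omega> \<in> L \<Longrightarrow> - \<omega> \<in> L"
  by (auto simp: l2_iff cochains_def)

lemma l2_diff: "\<omega> \<in> L \<Longrightarrow> \<eta> \<in> L \<Longrightarrow> \<omega> - \<eta> \<in> L"
  using l2_add[OF _ l2_uminus] by fastforce

lemma emb_add: "\<omega> \<in> L \<Longrightarrow> \<eta> \<in> L \<Longrightarrow> emb (\<omega> + \<eta>) = emb \<omega> + emb \<eta>"
  by (simp add: ell2_apply_inject[symmetric] fun_eq_iff plus_ell2.rep_eq emb_apply l2_add distrib_left)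

lemma emb_scale: "\<omega> \<in> L \<Longrightarrow> emb (\<lambda>\<tau>. c * \<omega> \<tau>) = c *\<^sub>R emb \<omega>"
  by (simp add: ell2_apply_inject[symmetric] fun_eq_iff scaleR_ell2.rep_eq emb_apply l2_scale)

lemma emb_uminus: "\<omega> \<in> L \<Longrightarrow> emb (- \<omega>) = - emb \<omega>"
  by (simp add: ell2_apply_inject[symmetric] fun_eq_iff uminus_ell2.rep_eq emb_apply l2_uminus)

lemma emb_diff: "\<omega> \<in> L \<Longrightarrow> \<eta> \<in> L \<Longrightarrow> emb (\<omega> - \<eta>) = emb \<omega> - emb \<eta>"
  by (simp add: ell2_apply_inject[symmetric] fun_eq_iff minus_ell2.rep_eq emb_apply l2_diff right_diff_distrib)

lemma emb_zero: "emb 0 = 0"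
  by (simp add: ell2_apply_inject[symmetric] fun_eq_iff zero_ell2.rep_eq emb_apply l2_zero)

lemma inner_emb:
  assumes "\<omega> \<in> L" "\<eta> \<in> L"
  shows "inner (emb \<omega>) (emb \<eta>) = ip \<omega> \<eta>"
  unfolding inner_ell2.rep_eq l2_inner_def
proof (rule infsum_cong_neutral)
  fix \<tau> assume "\<tau> \<in> UNIV \<inter> X"
  then have "sqrt (m \<tau>) * sqrt (m \<tau>) = m \<tau>" by (simp add: weight_pos less_imp_le)
  then show "ell2_apply (emb \<omega>) \<tau> * ell2_apply (emb \<eta>) \<tau> = m \<tau> * \<omega> \<tau> * \<eta> \<tau>"
    using assms by (simp add: emb_apply algebra_simps)
qed (use assms in \<open>auto simp: emb_apply cochain_zero[OF l2_cochain]\<close>)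

lemma norm_emb: "\<omega> \<in> L \<Longrightarrow> norm (emb \<omega>) = l2_norm K m \<omega>"
  by (simp add: norm_eq_sqrt_inner inner_emb l2_norm_def l2_inner_def power2_eq_square mult.assoc)

lemma inj_emb: "inj_on emb L"
proof (rule inj_onI)
  fix \<omega> \<eta> assume L: "\<omega> \<in> L" "\<eta> \<in> L" and "emb \<omega> = emb \<eta>"
  then have "sqrt (m \<tau>) * \<omega> \<tau> = sqrt (m \<tau>) * \<eta> \<tau>" for \<tau> by (metis emb_apply)
  with L show "\<omega> = \<eta>"
    by (intro cochain_eqI) (use weight_pos in \<open>force dest: l2_cochain\<close>)+
qed

text \<open>Division by \<open>sqrt (m \<tau>)\<close>, positive on \<open>X\<close>, inverts the
  embedding. Vanishing of coordinates is a closed condition, so limits of embedded cochains are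
  again embedded cochains.\<close>

lemma emb_image: "emb ` L = {x. \<forall>\<tau>\<in>- X. ell2_apply x \<tau> = 0}"
proof (intro equalityI subsetI)
  fix x assume "x \<in> {x. \<forall>\<tau>\<in>- X. ell2_apply x \<tau> = 0}"
  then have x: "\<And>\<tau>. \<tau> \<notin> X \<Longrightarrow> ell2_apply x \<tau> = 0" by simp
  define \<omega> where "\<omega> = (\<lambda>\<tau>. if \<tau> \<in> X then ell2_apply x \<tau> / sqrt (m \<tau>) else 0)"
  have eq: "sqrt (m \<tau>) * \<omega> \<tau> = ell2_apply x \<tau>" for \<tau>
    using x weight_pos[of \<tau>] by (cases "\<tau> \<in> X") (simp_all add: \<omega>_def)
  then have "\<omega> \<in> L"
    by (simp add: l2_iff ell2_square_summable) (simp add: cochains_def \<omega>_def)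
  moreover have "emb \<omega> = x"
    using \<open>\<omega> \<in> L\<close> by (simp add: ell2_apply_inject[symmetric] fun_eq_iff emb_apply eq)
  ultimately show "x \<in> emb ` L" by blast
qed (auto simp: emb_apply cochain_zero[OF l2_cochain])

lemma closed_emb_image: "closed (emb ` L)"
proof -
  have "{x. \<forall>\<tau>\<in>- X. ell2_apply x \<tau> = 0} = (\<Inter>\<tau>\<in>- X. {x. ell2_apply x \<tau> = 0})" by auto
  then show ?thesis
    unfolding emb_image by (auto intro!: closed_INT closed_Collect_eq continuous_intros)
qed

lemma l2_inner_commute: "ip \<omega> \<eta> = ip \<eta> \<omega>"
  by (simp add: l2_inner_def mult.commute mult.left_commute)

lemma l2_inner_add_left: "\<omega> \<in> L \<Longrightarrow> \<eta> \<in> L \<Longrightarrow> \<phi> \<in> L \<Longrightarrow> ip (\<omega> + \<eta>) \<phi> = ip \<omega> \<phi> + ip \<eta> \<phi>"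
  by (simp add: inner_emb[symmetric] l2_add emb_add inner_add_left)

lemma l2_inner_zero: "ip 0 \<phi> = 0" "ip \<phi> 0 = 0"
  by (simp_all add: l2_inner_def)

lemma l2_inner_self_eq_0: "\<omega> \<in> L \<Longrightarrow> ip \<omega> \<omega> = 0 \<longleftrightarrow> \<omega> = 0"
  using inj_onD[OF inj_emb, of \<omega> 0] by (auto simp: inner_emb[symmetric] emb_zero l2_zero)

lemma l2_norm_nonneg: "0 \<le> l2_norm K m \<omega>"
  unfolding l2_norm_def by (intro real_sqrt_ge_zero infsum_nonneg) (simp add: weight_pos less_imp_le)

lemma l2_norm_minus_commute: "l2_norm K m (\<omega> - \<eta>) = l2_norm K m (\<eta> - \<omega>)"
  by (simp add: l2_norm_def power2_commute)

lemma l2_closure_eq: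
  assumes "S \<subseteq> L"
  shows "l2_closure K m S = {\<omega> \<in> L. emb \<omega> \<in> closure (emb ` S)}"
  unfolding l2_closure_def
  by (rule metric_closure_of_isometric[OF _ _ inj_emb])
    (simp_all add: l2_norm_nonneg l2_norm_minus_commute dist_norm emb_diff[symmetric] norm_emb l2_diff assms)

lemma l2_closure_subset: "S \<subseteq> L \<Longrightarrow> l2_closure K m S \<subseteq> L"
  by (auto simp: l2_closure_eq)

text \<open>The annihilator of a vector is closed because the inner product is continuous.\<close>

lemma orthogonal_l2_closure:
  assumes "S \<subseteq> L" "\<eta> \<in> L" "\<And>s. s \<in> S \<Longrightarrow> ip \<eta> s = 0" "\<omega> \<in> l2_closure K m S"
  shows "ip \<eta> \<omega> = 0"
proof -
  have "closure (emb ` S) \<subseteq> {x. inner (emb \<eta>) x = 0}"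
    using assms(1-3)
    by (intro closure_minimal closed_Collect_eq continuous_intros) (auto simp: inner_emb subset_iff)
  then show ?thesis
    using assms by (auto simp: l2_closure_eq inner_emb)
qed

section \<open>Linear subspaces and projections in the weighted space\<close>

definition linear_subspace :: "'v cochain set \<Rightarrow> bool" where
  "linear_subspace S \<longleftrightarrow> S \<subseteq> L \<and> 0 \<in> S \<and> (\<forall>\<omega>\<in>S. \<forall>\<eta>\<in>S. \<omega> + \<eta> \<in> S)
     \<and> (\<forall>c. \<forall>\<omega>\<in>S. (\<lambda>\<tau>. c * \<omega> \<tau>) \<in> S)"

lemma linear_subspaceD:
  assumes "linear_subspace S"
  shows "S \<subseteq> L" "0 \<in> S" "\<omega> \<in> S \<Longrightarrow> \<eta> \<in> S \<Longrightarrow> \<omega> + \<eta> \<in> S" "\<omega> \<in> S \<Longrightarrow> (\<lambda>\<tau>. c * \<omega> \<tau>) \<in> S"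
  using assms by (auto simp: linear_subspace_def)

lemma linear_subspace_diff:
  assumes "linear_subspace S" "\<omega> \<in> S" "\<eta> \<in> S"
  shows "\<omega> - \<eta> \<in> S"
proof -
  have "\<omega> - \<eta> = \<omega> + (\<lambda>\<tau>. (-1) * \<eta> \<tau>)" by (simp add: fun_eq_iff)
  then show ?thesis using assms by (metis linear_subspaceD(3,4))
qed

lemma subspace_emb_image:
  assumes "linear_subspace S"
  shows "subspace (emb ` S)"
  unfolding subspace_def
proof (intro conjI ballI allI)
  note S = linear_subspaceD[OF assms]
  show "0 \<in> emb ` S" using S(2) emb_zero by (metis imageI)
  have "emb \<omega> + emb \<eta> \<in> emb ` S" if "\<omega> \<in> S" "\<eta> \<in> S" for \<omega> \<eta>
    using imageI[OF S(3)[OF that], of emb] S(1) that by (simp add: emb_add subsetD)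
  then show "x + y \<in> emb ` S" if "x \<in> emb ` S" "y \<in> emb ` S" for x y
    using that by blast
  have "c *\<^sub>R emb \<omega> \<in> emb ` S" if "\<omega> \<in> S" for c \<omega>
    using imageI[OF S(4)[OF that], of emb] S(1) that by (simp add: emb_scale subsetD)
  then show "c *\<^sub>R x \<in> emb ` S" if "x \<in> emb ` S" for c x
    using that by blast
qed

lemma linear_subspace_l2_closure:
  assumes "linear_subspace S"
  shows "linear_subspace (l2_closure K m S)"
proof -
  note S = linear_subspaceD[OF assms]
  have "subspace (closure (emb ` S))"
    using subspace_emb_image[OF assms] by (rule subspace_closure)
  then show ?thesis
    unfolding linear_subspace_def l2_closure_eq[OF S(1)]
    by (auto simp: l2_zero l2_add l2_scale emb_zero emb_add emb_scale
        intro: subspace_0 subspace_add subspace_scale)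
qed

lemma l2_projection:
  assumes "linear_subspace S" "\<omega> \<in> L"
  obtains p q where "p \<in> l2_closure K m S" "q \<in> L" "\<omega> = p + q" "\<And>s. s \<in> S \<Longrightarrow> ip q s = 0"
proof -
  note S = linear_subspaceD[OF assms(1)]
  obtain p' q' where p': "p' \<in> closure (emb ` S)" "emb \<omega> = p' + q'" "\<And>s. s \<in> emb ` S \<Longrightarrow> inner q' s = 0"
    using orthogonal_projection_exists[OF subspace_emb_image[OF assms(1)], of "emb \<omega>"] by blast
  \<comment> \<open>Limits of embedded elements of \<open>S\<close> stay in the closed image of
    \<open>L\<close>, so the projection found in \<open>ell2\<close> comes from a cochain.\<close>
  have "closure (emb ` S) \<subseteq> emb ` L"
    using S(1) closed_emb_image by (intro closure_minimal image_mono)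
  then obtain p where p: "p \<in> L" "p' = emb p" using p'(1) by blast
  have q: "emb (\<omega> - p) = q'" using assms(2) p p'(2) by (simp add: emb_diff)
  show thesis
  proof
    show "p \<in> l2_closure K m S" using p p'(1) S(1) by (simp add: l2_closure_eq)
    show "\<omega> - p \<in> L" using assms(2) p(1) by (rule l2_diff)
    show "\<omega> = p + (\<omega> - p)" by simp
    show "ip (\<omega> - p) s = 0" if "s \<in> S" for s
      using p'(3)[OF imageI, OF that] q that S(1) assms(2) p(1)
      by (metis inner_emb l2_diff subsetD)
  qed
qed

subsection \<open>Coboundary and boundary as adjoints\<close>

abbreviation \<theta> where "\<theta> \<equiv> incidence \<delta>"

lemma coboundary_cochain: "\<omega> \<in> cochains K m \<Longrightarrow> \<delta> \<omega> \<in> cochains K m"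
  and coboundary_add: "\<omega> \<in> cochains K m \<Longrightarrow> \<eta> \<in> cochains K m \<Longrightarrow> \<delta> (\<omega> + \<eta>) = \<delta> \<omega> + \<delta> \<eta>"
  and coboundary_scale: "\<omega> \<in> cochains K m \<Longrightarrow> \<delta> (\<lambda>\<tau>. c * \<omega> \<tau>) = (\<lambda>\<tau>. c * \<delta> \<omega> \<tau>)"
  and coboundary_coboundary: "\<omega> \<in> cochains K m \<Longrightarrow> \<delta> (\<delta> \<omega>) = 0"
  and coboundary_apply: "\<omega> \<in> cochains K m \<Longrightarrow> \<sigma> \<in> X \<Longrightarrow>
        \<delta> \<omega> \<sigma> = (\<Sum>\<tau> | \<tau> \<in> X \<and> covers \<tau> \<sigma>. \<omega> \<tau> * \<theta> \<tau> \<sigma>)"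
  using coboundary by (simp_all add: coboundary_operator_def)

lemma incidence_values: "\<tau> \<in> X \<Longrightarrow> \<sigma> \<in> X \<Longrightarrow> \<theta> \<tau> \<sigma> \<in> {-1, 0, 1}"
  and incidence_nonzero_iff: "\<tau> \<in> X \<Longrightarrow> \<sigma> \<in> X \<Longrightarrow> \<theta> \<tau> \<sigma> \<noteq> 0 \<longleftrightarrow> covers \<tau> \<sigma>"
  using coboundary unfolding coboundary_operator_def by blast+

lemma coboundary_zero: "\<delta> 0 = 0"
  using coboundary_scale[OF l2_cochain[OF l2_zero], of 0] by (simp add: zero_fun_def)

lemma indicator_cochain: "\<tau> \<in> X \<Longrightarrow> indicator {\<tau>} \<in> cochains K m"
  by (auto simp: cochains_def indicator_def)

lemma fin_cochain: "\<phi> \<in> Fc \<Longrightarrow> \<phi> \<in> cochains K m"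
  by (simp add: cochains_fin_def)

lemma fin_subset_l2: "Fc \<subseteq> L"
proof
  fix \<phi> assume \<phi>: "\<phi> \<in> Fc"
  then have "finite {\<tau> \<in> X. m \<tau> * (\<phi> \<tau>)\<^sup>2 \<noteq> 0}"
    by (auto simp: cochains_fin_def elim!: rev_finite_subset)
  then show "\<phi> \<in> L"
    using fin_cochain[OF \<phi>] by (simp add: l2_def finite_nonzero_values_imp_summable_on)
qed

lemma linear_subspace_fin: "linear_subspace Fc"
  unfolding linear_subspace_def
proof (intro conjI ballI allI fin_subset_l2)
  show "0 \<in> Fc" by (simp add: cochains_fin_def cochains_def)
  fix \<omega> c assume \<omega>: "\<omega> \<in> Fc"
  show "(\<lambda>\<tau>. c * \<omega> \<tau>) \<in> Fc"
    using \<omega> by (auto simp: cochains_fin_def cochains_def elim!: rev_finite_subset)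
  fix \<eta> assume \<eta>: "\<eta> \<in> Fc"
  have "finite ({\<tau>. \<omega> \<tau> \<noteq> 0} \<union> {\<tau>. \<eta> \<tau> \<noteq> 0})"
    using \<omega> \<eta> by (simp add: cochains_fin_def)
  then have "finite {\<tau>. \<omega> \<tau> + \<eta> \<tau> \<noteq> 0}" by (rule rev_finite_subset) auto
  then show "\<omega> + \<eta> \<in> Fc"
    using \<omega> \<eta> by (simp add: cochains_fin_def cochains_def)
qed

lemma indicator_fin: "\<tau> \<in> X \<Longrightarrow> indicator {\<tau>} \<in> Fc"
  by (simp add: cochains_fin_def indicator_cochain indicator_def)

lemma l2_inner_finite_support:
  assumes "finite S" "S \<subseteq> X" "\<And>\<tau>. \<tau> \<in> X - S \<Longrightarrow> \<omega> \<tau> * \<eta> \<tau> = 0"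
  shows "ip \<omega> \<eta> = (\<Sum>\<tau>\<in>S. m \<tau> * \<omega> \<tau> * \<eta> \<tau>)"
proof -
  have "ip \<omega> \<eta> = (\<Sum>\<^sub>\<infinity>\<tau>\<in>S. m \<tau> * \<omega> \<tau> * \<eta> \<tau>)"
    unfolding l2_inner_def
    by (rule infsum_cong_neutral) (use assms in \<open>auto simp: mult.assoc\<close>)
  then show ?thesis using assms(1) by simp
qed

lemma l2_inner_indicator: "\<sigma> \<in> X \<Longrightarrow> ip \<omega> (indicator {\<sigma>}) = m \<sigma> * \<omega> \<sigma>"
  by (subst l2_inner_finite_support[of "{\<sigma>}"]) (auto simp: indicator_def)

text \<open>Incidence numbers square to 1 on the cofaces of \<open>\<rho>\<close> and to 0
  elsewhere, so the squared norm is the sum of \<open>m\<close> over these cofaces, finite by local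
  summability.\<close>

lemma coboundary_indicator_l2:
  assumes "\<rho> \<in> X"
  shows "\<delta> (indicator {\<rho>}) \<in> L"
proof -
  have "(\<lambda>\<sigma>. m \<sigma> * (\<theta> \<rho> \<sigma>)\<^sup>2) summable_on X \<longleftrightarrow> m summable_on {\<sigma> \<in> X. covers \<rho> \<sigma>}"
    by (rule summable_on_cong_neutral)
      (use incidence_values[OF assms] incidence_nonzero_iff[OF assms] in force)+
  then show ?thesis
    using assms locally_summable coboundary_cochain[OF indicator_cochain[OF assms]]
    by (simp add: l2_def locally_summable_def incidence_def)
qed

text \<open>Since \<open>\<delta> 1\<^sub>\<rho>\<close> is square-summable, every coordinate of the boundary is continuous on \<open>\<ell>\<^sup>2\<close>.\<close>

lemma weight_times_boundary:
  assumes "\<rho> \<in> X"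
  shows "m \<rho> * bd \<omega> \<rho> = ip (\<delta> (indicator {\<rho>})) \<omega>"
proof -
  have "(\<Sum>\<^sub>\<infinity>\<tau>\<in>{\<tau> \<in> X. covers \<rho> \<tau>}. m \<tau> * \<omega> \<tau> * \<theta> \<rho> \<tau>) = ip (\<delta> (indicator {\<rho>})) \<omega>"
    unfolding l2_inner_def incidence_def[symmetric]
    by (rule infsum_cong_neutral) (use incidence_nonzero_iff[OF assms] in \<open>auto simp: mult_ac\<close>)
  then show ?thesis
    using assms weight_pos[OF assms] by (simp add: bdry_def)
qed

lemma boundary_cochain: "bd \<omega> \<in> cochains K m"
  by (simp add: bdry_def cochains_def)

text \<open>Cauchy-Schwarz over the cofaces of a face: \<open>m * \<bar>\<omega>\<bar>\<close> is
  the product of \<open>sqrt m\<close>, square-summable by local summability, and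
  \<open>sqrt m * \<bar>\<omega>\<bar>\<close>.\<close>

lemma l2_subset_l1: "L \<subseteq> cochains_l1 K m"
proof
  fix \<omega> assume \<omega>: "\<omega> \<in> L"
  have "(\<lambda>\<sigma>. m \<sigma> * \<bar>\<omega> \<sigma>\<bar>) summable_on {\<sigma> \<in> X. covers \<tau> \<sigma>}" (is "_ summable_on ?C") if "\<tau> \<in> X" for \<tau>
  proof -
    have m: "m summable_on ?C"
      using locally_summable that by (simp add: locally_summable_def)
    have "(\<lambda>\<sigma>. m \<sigma> * (\<omega> \<sigma>)\<^sup>2) summable_on ?C"
      by (rule summable_on_subset_banach[of _ X]) (use \<omega> in \<open>auto simp: l2_def\<close>)
    then have "(\<lambda>\<sigma>. (sqrt (m \<sigma>) * \<bar>\<omega> \<sigma>\<bar>)\<^sup>2) summable_on ?C"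
      by (rule summable_on_cong[THEN iffD1, rotated]) (auto simp: power_mult_distrib weight_pos less_imp_le)
    moreover have "(\<lambda>\<sigma>. (sqrt (m \<sigma>))\<^sup>2) summable_on ?C"
      using m by (rule summable_on_cong[THEN iffD1, rotated]) (auto simp: weight_pos less_imp_le)
    ultimately have "(\<lambda>\<sigma>. sqrt (m \<sigma>) * (sqrt (m \<sigma>) * \<bar>\<omega> \<sigma>\<bar>)) summable_on ?C"
      by (intro summable_mult_squares)
    then show ?thesis
      by (rule summable_on_cong[THEN iffD1, rotated])
        (auto simp: mult.assoc[symmetric] weight_pos less_imp_le)
  qed
  then show "\<omega> \<in> cochains_l1 K m"
    using \<omega> by (simp add: cochains_l1_def l2_cochain)
qed

lemma bdry_max_dom_eq: "bdry_max_dom K m \<delta> = {\<omega> \<in> L. bd \<omega> \<in> L}"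
  using l2_subset_l1 by (auto simp: bdry_max_dom_def)

lemma boundary_add:
  assumes "\<omega> \<in> L" "\<eta> \<in> L"
  shows "bd (\<omega> + \<eta>) = bd \<omega> + bd \<eta>"
proof (rule cochain_eqI)
  fix \<rho> assume "\<rho> \<in> X"
  then have "m \<rho> * bd (\<omega> + \<eta>) \<rho> = m \<rho> * (bd \<omega> + bd \<eta>) \<rho>"
    using assms
    by (simp add: weight_times_boundary distrib_left l2_inner_commute[of "\<delta> (indicator {\<rho>})"]
        l2_inner_add_left coboundary_indicator_l2)
  then show "bd (\<omega> + \<eta>) \<rho> = (bd \<omega> + bd \<eta>) \<rho>"
    using weight_pos[OF \<open>\<rho> \<in> X\<close>] by simp
qed (use boundary_cochain in \<open>auto simp: cochains_def\<close>)

lemma boundary_scale: "bd (\<lambda>\<tau>. c * \<omega> \<tau>) = (\<lambda>\<tau>. c * bd \<omega> \<tau>)"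
  by (simp add: bdry_def fun_eq_iff mult.assoc mult.left_commute[of _ c] infsum_cmult_right')

lemma boundary_diff:
  assumes "\<omega> \<in> L" "\<eta> \<in> L"
  shows "bd (\<omega> - \<eta>) = bd \<omega> - bd \<eta>"
proof -
  have "\<omega> - \<eta> = \<omega> + (\<lambda>\<tau>. (-1) * \<eta> \<tau>)" by (simp add: fun_eq_iff)
  then have "bd (\<omega> - \<eta>) = bd \<omega> + bd (\<lambda>\<tau>. (-1) * \<eta> \<tau>)"
    using assms l2_scale boundary_add by metis
  then show ?thesis unfolding boundary_scale by (simp add: fun_eq_iff)
qed

lemma boundary_zero: "bd 0 = 0"
  using boundary_scale[of 0 0] by (simp add: zero_fun_def)

text \<open>A simplex has finitely many facets, and the boundary is supported on facets of simplices
  in the support.\<close>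

lemma boundary_fin:
  assumes "\<phi> \<in> Fc"
  shows "bd \<phi> \<in> Fc"
proof -
  have "{\<rho>. bd \<phi> \<rho> \<noteq> 0} \<subseteq> (\<Union>\<tau>\<in>{\<tau>. \<phi> \<tau> \<noteq> 0}. {\<rho> \<in> X. covers \<rho> \<tau>})"
  proof
    fix \<rho> assume "\<rho> \<in> {\<rho>. bd \<phi> \<rho> \<noteq> 0}"
    then have "\<rho> \<in> X" and "(\<Sum>\<^sub>\<infinity>\<tau>\<in>{\<tau> \<in> X. covers \<rho> \<tau>}. m \<tau> * \<phi> \<tau> * \<theta> \<rho> \<tau>) \<noteq> 0"
      by (auto simp: bdry_def split: if_splits)
    then obtain \<tau> where "\<tau> \<in> X" "covers \<rho> \<tau>" "\<phi> \<tau> \<noteq> 0"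
      by (smt (verit) infsum_0 mem_Collect_eq mult_eq_0_iff)
    then show "\<rho> \<in> (\<Union>\<tau>\<in>{\<tau>. \<phi> \<tau> \<noteq> 0}. {\<rho> \<in> X. covers \<rho> \<tau>})"
      using \<open>\<rho> \<in> X\<close> by blast
  qed
  moreover have "finite (\<Union>\<tau>\<in>{\<tau>. \<phi> \<tau> \<noteq> 0}. {\<rho> \<in> X. covers \<rho> \<tau>})"
    using assms cochain_zero[OF fin_cochain[OF assms]]
    by (intro finite_UN_I finite_facets) (auto simp: cochains_fin_def)
  ultimately show ?thesis
    using boundary_cochain finite_subset by (auto simp: cochains_fin_def)
qed

text \<open>Both sides are one finite double sum taken in two orders. Finite support of
  \<open>\<phi>\<close> makes this meaningful for every cochain \<open>\<omega>\<close>, which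
  allows a weak characterisation of \<open>\<delta>\<close>.\<close>

lemma green_fin:
  assumes \<omega>: "\<omega> \<in> cochains K m" and \<phi>: "\<phi> \<in> Fc"
  shows "ip (\<delta> \<omega>) \<phi> = ip \<omega> (bd \<phi>)"
proof -
  define S where "S = {\<sigma>. \<phi> \<sigma> \<noteq> 0}"
  \<comment> \<open>\<open>T\<close> collects the facets of the support, hence every face with a
    non-zero incidence number to some \<open>\<sigma>\<close> in \<open>S\<close>.\<close>
  define T where "T = (\<Union>\<sigma>\<in>S. {\<tau> \<in> X. covers \<tau> \<sigma>})"
  have S: "finite S" "S \<subseteq> X"
    using \<phi> cochain_zero[OF fin_cochain[OF \<phi>]] by (auto simp: S_def cochains_fin_def)
  then have T: "finite T" "T \<subseteq> X"
    by (auto simp: T_def intro!: finite_facets)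
  have \<delta>: "\<delta> \<omega> \<sigma> = (\<Sum>\<tau>\<in>T. \<omega> \<tau> * \<theta> \<tau> \<sigma>)" if "\<sigma> \<in> S" for \<sigma>
  proof -
    have "\<sigma> \<in> X" using that S by blast
    then have "\<delta> \<omega> \<sigma> = (\<Sum>\<tau> | \<tau> \<in> X \<and> covers \<tau> \<sigma>. \<omega> \<tau> * \<theta> \<tau> \<sigma>)"
      using \<omega> by (rule coboundary_apply[rotated])
    also have "\<dots> = (\<Sum>\<tau>\<in>T. \<omega> \<tau> * \<theta> \<tau> \<sigma>)"
      using T \<open>\<sigma> \<in> X\<close> that incidence_nonzero_iff
      by (intro sum.mono_neutral_left) (auto simp: T_def)
    finally show ?thesis .
  qed
  have \<partial>: "m \<tau> * bd \<phi> \<tau> = (\<Sum>\<sigma>\<in>S. m \<sigma> * \<theta> \<tau> \<sigma> * \<phi> \<sigma>)" if "\<tau> \<in> X" for \<tau>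
    unfolding weight_times_boundary[OF that] incidence_def
    by (rule l2_inner_finite_support[OF S]) (simp add: S_def)
  have "bd \<phi> \<tau> = 0" if "\<tau> \<in> X - T" for \<tau>
  proof -
    have "\<theta> \<tau> \<sigma> = 0" if "\<sigma> \<in> S" for \<sigma>
      using that \<open>\<tau> \<in> X - T\<close> S incidence_nonzero_iff[of \<tau> \<sigma>] by (auto simp: T_def)
    then show ?thesis using \<partial>[of \<tau>] weight_pos[of \<tau>] that by simp
  qed
  then have "ip \<omega> (bd \<phi>) = (\<Sum>\<tau>\<in>T. m \<tau> * \<omega> \<tau> * bd \<phi> \<tau>)"
    using T by (intro l2_inner_finite_support) auto
  also have "\<dots> = (\<Sum>\<tau>\<in>T. \<omega> \<tau> * (\<Sum>\<sigma>\<in>S. m \<sigma> * \<theta> \<tau> \<sigma> * \<phi> \<sigma>))"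
  proof (rule sum.cong[OF refl])
    fix \<tau> assume "\<tau> \<in> T"
    then have "m \<tau> * \<omega> \<tau> * bd \<phi> \<tau> = \<omega> \<tau> * (m \<tau> * bd \<phi> \<tau>)" by simp
    also have "m \<tau> * bd \<phi> \<tau> = (\<Sum>\<sigma>\<in>S. m \<sigma> * \<theta> \<tau> \<sigma> * \<phi> \<sigma>)"
      using \<open>\<tau> \<in> T\<close> T by (intro \<partial>) auto
    finally show "m \<tau> * \<omega> \<tau> * bd \<phi> \<tau> = \<omega> \<tau> * (\<Sum>\<sigma>\<in>S. m \<sigma> * \<theta> \<tau> \<sigma> * \<phi> \<sigma>)" .
  qed
  also have "\<dots> = (\<Sum>\<sigma>\<in>S. m \<sigma> * (\<Sum>\<tau>\<in>T. \<omega> \<tau> * \<theta> \<tau> \<sigma>) * \<phi> \<sigma>)"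
    by (simp add: sum_distrib_left sum_distrib_right sum.swap[of _ T] mult_ac)
  also have "\<dots> = (\<Sum>\<sigma>\<in>S. m \<sigma> * \<delta> \<omega> \<sigma> * \<phi> \<sigma>)"
    by (simp add: \<delta>)
  also have "\<dots> = ip (\<delta> \<omega>) \<phi>"
    using S by (intro l2_inner_finite_support[symmetric]) (auto simp: S_def)
  finally show ?thesis by simp
qed

text \<open>Indicators of single faces are finitely supported and recover each value. This is the
  adjoint property: a square-summable \<open>\<eta>\<close> that passes the test puts a
  square-summable \<open>\<omega>\<close> into the domain of
  \<open>\<delta>\<^sub>N\<close>.\<close>

lemma coboundary_eqI:
  assumes "\<omega> \<in> cochains K m" "\<eta> \<in> cochains K m"
    and "\<And>\<phi>. \<phi> \<in> Fc \<Longrightarrow> ip \<eta> \<phi> = ip \<omega> (bd \<phi>)"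
  shows "\<delta> \<omega> = \<eta>"
proof (rule cochain_eqI)
  fix \<sigma> assume \<sigma>: "\<sigma> \<in> X"
  then have "ip (\<delta> \<omega>) (indicator {\<sigma>}) = ip \<eta> (indicator {\<sigma>})"
    by (simp add: assms green_fin indicator_fin)
  then show "\<delta> \<omega> \<sigma> = \<eta> \<sigma>"
    using weight_pos[OF \<sigma>] by (simp add: \<sigma> l2_inner_indicator)
qed (use assms coboundary_cochain in auto)

section \<open>Closed graph of the boundary operator\<close>

definition graph_emb :: "'v cochain \<Rightarrow> 'v set ell2 \<times> 'v set ell2" where
  "graph_emb \<omega> = (emb \<omega>, emb (bd \<omega>))"

text \<open>This is the domain of \<open>\<partial>\<^sub>D\<close>: \<open>graph_emb\<close>
  carries the graph norm to the product norm, so closing \<open>Fc\<close> in the graph norm means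
  closing its graph.\<close>

definition dom_bdry :: "'v cochain set" where
  "dom_bdry = {\<omega> \<in> L. bd \<omega> \<in> L \<and> graph_emb \<omega> \<in> closure (graph_emb ` Fc)}"

definition dom_cobd :: "'v cochain set" where
  "dom_cobd = {\<omega> \<in> L. \<delta> \<omega> \<in> L}"

lemma graph_emb_zero: "graph_emb 0 = 0"
  by (simp add: graph_emb_def boundary_zero emb_zero zero_prod_def)

lemma graph_emb_add:
  assumes "\<omega> \<in> L" "bd \<omega> \<in> L" "\<eta> \<in> L" "bd \<eta> \<in> L"
  shows "graph_emb (\<omega> + \<eta>) = graph_emb \<omega> + graph_emb \<eta>"
  using assms by (simp add: graph_emb_def boundary_add emb_add)

lemma graph_emb_scale:
  assumes "\<omega> \<in> L" "bd \<omega> \<in> L"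
  shows "graph_emb (\<lambda>\<tau>. c * \<omega> \<tau>) = c *\<^sub>R graph_emb \<omega>"
  using assms by (simp add: graph_emb_def boundary_scale emb_scale)

lemma subspace_graph_fin: "subspace (graph_emb ` Fc)"
  unfolding subspace_def
proof (intro conjI ballI allI)
  note lin = linear_subspaceD[OF linear_subspace_fin]
  have Fc: "\<phi> \<in> L" "bd \<phi> \<in> L" if "\<phi> \<in> Fc" for \<phi>
    using that boundary_fin fin_subset_l2 by auto
  show "0 \<in> graph_emb ` Fc" using lin(2) graph_emb_zero by (metis imageI)
  fix x c assume "x \<in> graph_emb ` Fc"
  then obtain \<phi> where \<phi>: "\<phi> \<in> Fc" "x = graph_emb \<phi>" by blast
  show "c *\<^sub>R x \<in> graph_emb ` Fc"
    unfolding \<phi>(2) graph_emb_scale[OF Fc[OF \<phi>(1)], symmetric] by (intro imageI lin(4) \<phi>(1))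
  fix y assume "y \<in> graph_emb ` Fc"
  then obtain \<psi> where \<psi>: "\<psi> \<in> Fc" "y = graph_emb \<psi>" by blast
  show "x + y \<in> graph_emb ` Fc"
    unfolding \<phi>(2) \<psi>(2) graph_emb_add[OF Fc[OF \<phi>(1)] Fc[OF \<psi>(1)], symmetric]
    by (intro imageI lin(3) \<phi>(1) \<psi>(1))
qed

lemma closure_fin_eq_dom_bdry:
  "Metric_space.mtopology (bdry_max_dom K m \<delta>) (\<lambda>\<omega> \<eta>. bdry_graph_norm K m \<delta> (\<omega> - \<eta>))
     closure_of Fc = dom_bdry"
proof -
  let ?M = "bdry_max_dom K m \<delta>"
  \<comment> \<open>Symmetry is demanded of all functions, also outside \<open>L\<close>; hence
    homogeneity of \<open>bd\<close> with factor -1 is used, additivity being available on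
    \<open>L\<close>.\<close>
  have "bdry_graph_norm K m \<delta> (\<omega> - \<eta>) = bdry_graph_norm K m \<delta> (\<eta> - \<omega>)" for \<omega> \<eta>
  proof -
    have "\<omega> - \<eta> = (\<lambda>\<tau>. (-1) * (\<eta> - \<omega>) \<tau>)" by (simp add: fun_eq_iff)
    then have "bd (\<omega> - \<eta>) = (\<lambda>\<tau>. (-1) * bd (\<eta> - \<omega>) \<tau>)"
      by (metis boundary_scale)
    then have "l2_norm K m (bd (\<omega> - \<eta>)) = l2_norm K m (bd (\<eta> - \<omega>))"
      by (simp add: l2_norm_def)
    then show ?thesis
      by (simp add: bdry_graph_norm_def l2_norm_minus_commute[of \<omega> \<eta>])
  qed
  moreover have "bdry_graph_norm K m \<delta> (\<omega> - \<eta>) = dist (graph_emb \<omega>) (graph_emb \<eta>)"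
    if "\<omega> \<in> ?M" "\<eta> \<in> ?M" for \<omega> \<eta>
    using that
    by (simp add: bdry_max_dom_eq bdry_graph_norm_def graph_emb_def dist_norm norm_Pair
        emb_diff[symmetric] norm_emb l2_diff boundary_diff add.commute)
  moreover have "inj_on graph_emb ?M"
    by (rule inj_onI) (auto simp: graph_emb_def bdry_max_dom_eq dest: inj_onD[OF inj_emb])
  moreover have "Fc \<subseteq> ?M"
    using fin_subset_l2 boundary_fin by (auto simp: bdry_max_dom_eq)
  ultimately have "Metric_space.mtopology ?M (\<lambda>\<omega> \<eta>. bdry_graph_norm K m \<delta> (\<omega> - \<eta>)) closure_of Fc
      = {\<omega> \<in> ?M. graph_emb \<omega> \<in> closure (graph_emb ` Fc)}"
    by (intro metric_closure_of_isometric) (auto simp: bdry_graph_norm_def)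
  then show ?thesis by (auto simp: dom_bdry_def bdry_max_dom_eq)
qed

text \<open>Up to the weight, each coordinate of \<open>bd \<omega>\<close> is an inner product of
  \<open>\<omega>\<close> with a fixed vector of \<open>L\<close>, hence continuous; so a limit of
  graph points is again a graph point.\<close>

lemma closure_graph_fin:
  "closure (graph_emb ` Fc) = graph_emb ` dom_bdry"
proof
  show "graph_emb ` dom_bdry \<subseteq> closure (graph_emb ` Fc)" by (auto simp: dom_bdry_def)
  \<comment> \<open>The equation in \<open>?C\<close> is \<open>weight_times_boundary\<close> read
    in \<open>ell2\<close>; the factor \<open>sqrt (m \<rho>)\<close> completes the one contained in
    \<open>emb\<close> to \<open>m \<rho>\<close>.\<close>
  let ?C = "(emb ` L \<times> emb ` L) \<inter>
    (\<Inter>\<rho>\<in>X. {z. inner (emb (\<delta> (indicator {\<rho>}))) (fst z) = sqrt (m \<rho>) * ell2_apply (snd z) \<rho>})"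
  have "graph_emb \<phi> \<in> ?C" if "\<phi> \<in> Fc" for \<phi>
  proof -
    have L: "\<phi> \<in> L" "bd \<phi> \<in> L" using that boundary_fin fin_subset_l2 by auto
    have "sqrt (m \<rho>) * (sqrt (m \<rho>) * bd \<phi> \<rho>) = m \<rho> * bd \<phi> \<rho>" if "\<rho> \<in> X" for \<rho>
      using weight_pos[OF that] by (simp add: mult.assoc[symmetric])
    then show ?thesis
      using L by (simp add: graph_emb_def inner_emb emb_apply coboundary_indicator_l2 weight_times_boundary)
  qed
  moreover have "closed ?C"
    by (intro closed_Int closed_Times closed_emb_image closed_INT ballI closed_Collect_eq
        continuous_intros continuous_on_compose2[OF continuous_on_ell2_apply[OF continuous_on_id]]) auto
  ultimately have sub: "closure (graph_emb ` Fc) \<subseteq> ?C"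
    by (intro closure_minimal image_subsetI)
  show "closure (graph_emb ` Fc) \<subseteq> graph_emb ` dom_bdry"
  proof
    fix z assume z: "z \<in> closure (graph_emb ` Fc)"
    with sub have "z \<in> ?C" by blast
    then obtain \<omega> \<eta> where L: "\<omega> \<in> L" "\<eta> \<in> L" and z_eq: "z = (emb \<omega>, emb \<eta>)"
      and eq: "\<And>\<rho>. \<rho> \<in> X \<Longrightarrow> inner (emb (\<delta> (indicator {\<rho>}))) (emb \<omega>) = sqrt (m \<rho>) * ell2_apply (emb \<eta>) \<rho>"
      by auto
    have "bd \<omega> = \<eta>"
    proof (rule cochain_eqI)
      fix \<rho> assume \<rho>: "\<rho> \<in> X"
      have "m \<rho> * bd \<omega> \<rho> = sqrt (m \<rho>) * (sqrt (m \<rho>) * \<eta> \<rho>)"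
        using eq[OF \<rho>] L \<rho> by (simp add: weight_times_boundary inner_emb coboundary_indicator_l2 emb_apply)
      then show "bd \<omega> \<rho> = \<eta> \<rho>"
        using weight_pos[OF \<rho>] by (simp add: mult.assoc[symmetric])
    qed (use L boundary_cochain l2_cochain in auto)
    then have "z = graph_emb \<omega>" by (simp add: z_eq graph_emb_def)
    moreover have "\<omega> \<in> dom_bdry"
      using z L \<open>bd \<omega> = \<eta>\<close> calculation by (simp add: dom_bdry_def)
    ultimately show "z \<in> graph_emb ` dom_bdry" by blast
  qed
qed

lemma dom_bdry_D: "\<omega> \<in> dom_bdry \<Longrightarrow> \<omega> \<in> L" "\<omega> \<in> dom_bdry \<Longrightarrow> bd \<omega> \<in> L"
  by (simp_all add: dom_bdry_def)

lemma dom_cobd_D: "\<omega> \<in> dom_cobd \<Longrightarrow> \<omega> \<in> L" "\<omega> \<in> dom_cobd \<Longrightarrow> \<delta> \<omega> \<in> L"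
  by (simp_all add: dom_cobd_def)

lemma dom_bdry_add: "\<omega> + \<eta> \<in> dom_bdry" if "\<omega> \<in> dom_bdry" "\<eta> \<in> dom_bdry"
  using subspace_add[OF subspace_closure[OF subspace_graph_fin]] that
  by (simp add: dom_bdry_def graph_emb_add boundary_add l2_add)

lemma dom_bdry_scale: "(\<lambda>\<tau>. c * \<omega> \<tau>) \<in> dom_bdry" if "\<omega> \<in> dom_bdry"
  using subspace_scale[OF subspace_closure[OF subspace_graph_fin]] that
  by (simp add: dom_bdry_def graph_emb_scale boundary_scale l2_scale)

lemma fin_subset_dom_bdry: "Fc \<subseteq> dom_bdry"
  using fin_subset_l2 boundary_fin closure_subset by (fastforce simp: dom_bdry_def)

text \<open>For fixed \<open>\<omega>\<close> the pairs satisfying the identity form a closed set;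
  it contains the graph over \<open>Fc\<close>, hence also the closed graph.\<close>

lemma green:
  assumes "\<omega> \<in> dom_cobd" "\<phi> \<in> dom_bdry"
  shows "ip (\<delta> \<omega>) \<phi> = ip \<omega> (bd \<phi>)"
proof -
  have "graph_emb \<phi> \<in> {z. inner (emb (\<delta> \<omega>)) (fst z) = inner (emb \<omega>) (snd z)}"
  proof (rule subsetD[OF closure_minimal])
    show "graph_emb \<phi> \<in> closure (graph_emb ` Fc)"
      using assms(2) by (simp add: dom_bdry_def)
    show "graph_emb ` Fc \<subseteq> {z. inner (emb (\<delta> \<omega>)) (fst z) = inner (emb \<omega>) (snd z)}"
      using dom_cobd_D[OF assms(1)] fin_subset_l2 boundary_fin
      by (auto simp: graph_emb_def inner_emb subset_iff green_fin l2_cochain)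
    show "closed {z. inner (emb (\<delta> \<omega>)) (fst z) = inner (emb \<omega>) (snd z)}"
      by (intro closed_Collect_eq continuous_intros)
  qed
  then show ?thesis
    using dom_cobd_D[OF assms(1)] dom_bdry_D[OF assms(2)] by (simp add: graph_emb_def inner_emb)
qed

text \<open>
  The kernel part of \<open>\<delta>\<^sub>N\<^sup>* = \<partial>\<^sub>D\<close>. A vector of the orthogonal complement of the graph of
  \<open>\<partial>\<close> on \<open>F\<^sup>c\<close> has the form \<open>(- \<delta> \<beta>, \<beta>)\<close>; projecting \<open>(\<omega>, 0)\<close> onto the closed graph
  leaves a remainder of this form that is orthogonal to \<open>(\<omega>, 0)\<close>, hence zero.
\<close>

lemma orthogonal_range_coboundary:
  assumes \<omega>: "\<omega> \<in> L" and orth: "\<And>\<alpha>. \<alpha> \<in> dom_cobd \<Longrightarrow> ip \<omega> (\<delta> \<alpha>) = 0"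
  shows "\<omega> \<in> dom_bdry" "bd \<omega> = 0"
proof -
  have Fc: "\<phi> \<in> L" "bd \<phi> \<in> L" if "\<phi> \<in> Fc" for \<phi>
    using that boundary_fin fin_subset_l2 by auto
  obtain p q where p: "p \<in> closure (graph_emb ` Fc)" and pq: "(emb \<omega>, 0) = p + q"
    and q: "\<And>s. s \<in> graph_emb ` Fc \<Longrightarrow> inner q s = 0"
    using orthogonal_projection_exists[OF subspace_graph_fin] by metis
  obtain \<phi> where \<phi>: "\<phi> \<in> dom_bdry" "p = graph_emb \<phi>"
    using p by (auto simp: closure_graph_fin)
  \<comment> \<open>These are the components of the remainder
    \<open>q = (emb \<omega>, 0) - graph_emb \<phi>\<close>, read as cochains.\<close>
  define \<alpha> \<beta> where "\<alpha> = \<omega> - \<phi>" and "\<beta> = - bd \<phi>"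
  have L: "\<phi> \<in> L" "bd \<phi> \<in> L" "\<alpha> \<in> L" "\<beta> \<in> L"
    using \<omega> dom_bdry_D[OF \<phi>(1)] by (auto simp: \<alpha>_def \<beta>_def l2_diff l2_uminus)
  have q_eq: "q = (emb \<alpha>, emb \<beta>)"
  proof -
    have "q = (emb \<omega>, 0) - graph_emb \<phi>" using pq \<phi>(2) by (metis add_diff_cancel_left')
    then show ?thesis
      using \<omega> L by (simp add: graph_emb_def \<alpha>_def \<beta>_def emb_diff emb_uminus)
  qed
  have "\<delta> \<beta> = - \<alpha>"
  proof (rule coboundary_eqI)
    fix \<psi> assume \<psi>: "\<psi> \<in> Fc"
    then have "inner q (graph_emb \<psi>) = 0" using q by blast
    then have "ip \<alpha> \<psi> + ip \<beta> (bd \<psi>) = 0"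
      using L Fc[OF \<psi>] by (simp add: q_eq graph_emb_def inner_emb)
    moreover have "ip (- \<alpha>) \<psi> = - ip \<alpha> \<psi>"
      using L Fc[OF \<psi>] by (simp add: inner_emb[symmetric] l2_uminus emb_uminus)
    ultimately show "ip (- \<alpha>) \<psi> = ip \<beta> (bd \<psi>)" by simp
  qed (use L l2_uminus l2_cochain in auto)
  then have "\<beta> \<in> dom_cobd" using L by (simp add: dom_cobd_def l2_uminus)
  then have "ip \<omega> (- \<alpha>) = 0" using orth \<open>\<delta> \<beta> = - \<alpha>\<close> by metis
  then have "inner q (emb \<omega>, 0) = 0"
    using L \<omega> by (simp add: q_eq inner_emb[symmetric] l2_uminus emb_uminus inner_commute)
  moreover have "inner q p = 0"
  proof -
    have "closure (graph_emb ` Fc) \<subseteq> {z. inner q z = 0}"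
      using q by (intro closure_minimal closed_Collect_eq continuous_intros) auto
    then show ?thesis using p by blast
  qed
  \<comment> \<open>\<open>q\<close> is orthogonal to \<open>(emb \<omega>, 0)\<close> and to
    \<open>p\<close>, hence to their difference, which is \<open>q\<close> itself.\<close>
  moreover have "inner q (emb \<omega>, 0) = inner q p + inner q q"
    unfolding pq by (rule inner_add_right)
  ultimately have "q = 0" by simp
  then have "graph_emb \<phi> = (emb \<omega>, 0)" using pq \<phi>(2) by simp
  then have "\<phi> = \<omega>" and "bd \<phi> = 0"
    using \<omega> L inj_onD[OF inj_emb] l2_zero emb_zero by (auto simp: graph_emb_def)
  then show "\<omega> \<in> dom_bdry" "bd \<omega> = 0" using \<phi> by auto
qed

subsection \<open>Harmonic cochains\<close>

abbreviation RN where "RN \<equiv> ran (delta_N K m \<delta>)"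
abbreviation RD where "RD \<equiv> ran (bdry_D K m \<delta>)"
abbreviation harm where "harm \<equiv> op_ker (Laplacian K m \<delta>)"

lemma delta_N_eq: "delta_N K m \<delta> = (\<lambda>\<omega>. if \<omega> \<in> dom_cobd then Some (\<delta> \<omega>) else None)"
  by (auto simp: delta_N_def dom_cobd_def restrict_map_def)

lemma bdry_D_eq: "bdry_D K m \<delta> = (\<lambda>\<omega>. if \<omega> \<in> dom_bdry then Some (bd \<omega>) else None)"
  unfolding bdry_D_def closure_fin_eq_dom_bdry by (auto simp: restrict_map_def)

lemma ran_delta_N: "RN = \<delta> ` dom_cobd"
  by (auto simp: delta_N_eq ran_def split: if_splits)

lemma ran_bdry_D: "RD = bd ` dom_bdry"
  by (auto simp: bdry_D_eq ran_def split: if_splits)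

lemma ran_delta_N_subset: "RN \<subseteq> L"
  using dom_cobd_D by (auto simp: ran_delta_N)

lemma ran_bdry_D_subset: "RD \<subseteq> L"
  using dom_bdry_D by (auto simp: ran_bdry_D)

lemma coboundary_dom_cobd: "\<omega> \<in> dom_cobd \<Longrightarrow> \<delta> \<omega> \<in> dom_cobd"
  by (simp add: dom_cobd_def coboundary_coboundary l2_zero l2_cochain)

lemma zero_dom_cobd: "0 \<in> dom_cobd"
  by (simp add: dom_cobd_def coboundary_zero l2_zero)

lemma zero_dom_bdry: "0 \<in> dom_bdry"
  using fin_subset_dom_bdry linear_subspaceD(2)[OF linear_subspace_fin] by blast

lemma linear_subspace_ran_delta_N: "linear_subspace RN"
  unfolding linear_subspace_def ran_delta_N
proof (intro conjI ballI allI)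
  show "\<delta> ` dom_cobd \<subseteq> L" using dom_cobd_D by auto
  show "0 \<in> \<delta> ` dom_cobd" by (rule rev_image_eqI[OF zero_dom_cobd]) (simp add: coboundary_zero)
  fix x c assume "x \<in> \<delta> ` dom_cobd"
  then obtain \<omega> where \<omega>: "\<omega> \<in> dom_cobd" "x = \<delta> \<omega>" by blast
  have "(\<lambda>\<tau>. c * \<omega> \<tau>) \<in> dom_cobd"
    using dom_cobd_D[OF \<omega>(1)] by (simp add: dom_cobd_def coboundary_scale l2_cochain l2_scale)
  then show "(\<lambda>\<tau>. c * x \<tau>) \<in> \<delta> ` dom_cobd"
    by (rule rev_image_eqI) (simp add: \<omega>(2) coboundary_scale l2_cochain dom_cobd_D(1)[OF \<omega>(1)])
  fix y assume "y \<in> \<delta> ` dom_cobd"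
  then obtain \<eta> where \<eta>: "\<eta> \<in> dom_cobd" "y = \<delta> \<eta>" by blast
  have "\<delta> (\<omega> + \<eta>) = x + y"
    using \<omega> \<eta> by (simp add: coboundary_add l2_cochain dom_cobd_D(1))
  moreover have "\<omega> + \<eta> \<in> dom_cobd"
    using \<omega> \<eta> calculation by (simp add: dom_cobd_def l2_add)
  ultimately show "x + y \<in> \<delta> ` dom_cobd" by (intro rev_image_eqI[of "\<omega> + \<eta>"]) simp_all
qed

lemma linear_subspace_ran_bdry_D: "linear_subspace RD"
  unfolding linear_subspace_def ran_bdry_D
proof (intro conjI ballI allI)
  show "bd ` dom_bdry \<subseteq> L" using dom_bdry_D by auto
  show "0 \<in> bd ` dom_bdry" by (rule rev_image_eqI[OF zero_dom_bdry]) (simp add: boundary_zero)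
  fix x c assume "x \<in> bd ` dom_bdry"
  then obtain \<omega> where \<omega>: "\<omega> \<in> dom_bdry" "x = bd \<omega>" by blast
  show "(\<lambda>\<tau>. c * x \<tau>) \<in> bd ` dom_bdry"
    by (rule rev_image_eqI[OF dom_bdry_scale[OF \<omega>(1), of c]]) (simp add: \<omega>(2) boundary_scale)
  fix y assume "y \<in> bd ` dom_bdry"
  then obtain \<eta> where \<eta>: "\<eta> \<in> dom_bdry" "y = bd \<eta>" by blast
  show "x + y \<in> bd ` dom_bdry"
    by (rule rev_image_eqI[OF dom_bdry_add[OF \<omega>(1) \<eta>(1)]])
      (simp add: \<omega>(2) \<eta>(2) boundary_add dom_bdry_D(1)[OF \<omega>(1)] dom_bdry_D(1)[OF \<eta>(1)])
qed

text \<open>The weak characterisation \<open>coboundary_eqI\<close> with target 0; the counterpart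
  of \<open>orthogonal_range_coboundary\<close> for the range of the boundary.\<close>

lemma orthogonal_range_boundary:
  assumes "\<omega> \<in> L" "\<And>\<phi>. \<phi> \<in> Fc \<Longrightarrow> ip \<omega> (bd \<phi>) = 0"
  shows "\<delta> \<omega> = 0"
  using assms by (intro coboundary_eqI) (auto simp: l2_cochain l2_zero l2_inner_zero)

lemma op_ker_Laplacian: "harm = {\<omega> \<in> dom_bdry. \<delta> \<omega> = 0 \<and> bd \<omega> = 0}"
proof (intro equalityI subsetI)
  fix \<omega> assume "\<omega> \<in> harm"
  \<comment> \<open>The natural domains of the two products supply exactly the four memberships that
    the two uses of \<open>green\<close> below require.\<close>
  then have \<omega>: "\<omega> \<in> dom_bdry" "bd \<omega> \<in> dom_cobd" "\<omega> \<in> dom_cobd" "\<delta> \<omega> \<in> dom_bdry" "\<delta> (bd \<omega>) + bd (\<delta> \<omega>) = 0"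
    by (auto simp: op_ker_def Laplacian_def op_add_def delta_N_eq bdry_D_eq restrict_map_def
        map_comp_def split: if_splits option.splits)
  note L = dom_bdry_D[OF \<omega>(1)] dom_cobd_D[OF \<omega>(2)] dom_cobd_D[OF \<omega>(3)] dom_bdry_D[OF \<omega>(4)]
  have "0 = ip (\<delta> (bd \<omega>) + bd (\<delta> \<omega>)) \<omega>"
    by (simp add: \<omega>(5) l2_inner_zero)
  also have "\<dots> = ip (\<delta> (bd \<omega>)) \<omega> + ip \<omega> (bd (\<delta> \<omega>))"
    using L by (simp add: l2_inner_add_left l2_inner_commute[of "bd (\<delta> \<omega>)" \<omega>])
  also have "\<dots> = ip (bd \<omega>) (bd \<omega>) + ip (\<delta> \<omega>) (\<delta> \<omega>)"
    using green[OF \<omega>(2,1)] green[OF \<omega>(3,4)] by simp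
  finally have "ip (bd \<omega>) (bd \<omega>) + ip (\<delta> \<omega>) (\<delta> \<omega>) = 0" by simp
  moreover have "0 \<le> ip \<eta> \<eta>" if "\<eta> \<in> L" for \<eta>
    using that by (simp add: inner_emb[symmetric])
  ultimately have "ip (bd \<omega>) (bd \<omega>) = 0" "ip (\<delta> \<omega>) (\<delta> \<omega>) = 0"
    using L(2,6) by (smt (verit))+
  then show "\<omega> \<in> {\<omega> \<in> dom_bdry. \<delta> \<omega> = 0 \<and> bd \<omega> = 0}"
    using \<omega> L by (simp add: l2_inner_self_eq_0)
next
  fix \<omega> assume "\<omega> \<in> {\<omega> \<in> dom_bdry. \<delta> \<omega> = 0 \<and> bd \<omega> = 0}"
  then have "\<omega> \<in> dom_bdry" "\<delta> \<omega> = 0" "bd \<omega> = 0" by auto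
  moreover from this have "\<omega> \<in> dom_cobd" by (simp add: dom_cobd_def dom_bdry_D(1) l2_zero)
  ultimately show "\<omega> \<in> harm"
    by (simp add: op_ker_def Laplacian_def op_add_def delta_N_eq bdry_D_eq restrict_map_def
        map_comp_def zero_dom_cobd zero_dom_bdry coboundary_zero boundary_zero dom_def)
qed

text \<open>Green's formula makes harmonic cochains orthogonal to both ranges; conversely,
  orthogonality to \<open>RN\<close> gives membership in \<open>dom_bdry\<close> with
  \<open>bd \<omega> = 0\<close>, and orthogonality to \<open>RD\<close> gives
  \<open>\<delta> \<omega> = 0\<close>.\<close>

lemma op_ker_Laplacian_orthogonal:
  "harm = {\<omega> \<in> L. (\<forall>\<eta>\<in>RN. ip \<omega> \<eta> = 0) \<and> (\<forall>\<eta>\<in>RD. ip \<omega> \<eta> = 0)}"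
proof (intro equalityI subsetI)
  fix \<omega> assume "\<omega> \<in> harm"
  then have \<omega>: "\<omega> \<in> dom_bdry" "\<delta> \<omega> = 0" "bd \<omega> = 0" by (auto simp: op_ker_Laplacian)
  then have L: "\<omega> \<in> L" and "\<omega> \<in> dom_cobd" by (simp_all add: dom_cobd_def dom_bdry_D(1) l2_zero)
  have "ip \<omega> (bd \<phi>) = 0" if "\<phi> \<in> dom_bdry" for \<phi>
    using green[OF \<open>\<omega> \<in> dom_cobd\<close> that] \<omega> by (simp add: l2_inner_zero)
  moreover have "ip \<omega> (\<delta> \<alpha>) = 0" if "\<alpha> \<in> dom_cobd" for \<alpha>
    using green[OF that \<omega>(1)] \<omega> by (simp add: l2_inner_zero l2_inner_commute)
  ultimately show "\<omega> \<in> {\<omega> \<in> L. (\<forall>\<eta>\<in>RN. ip \<omega> \<eta> = 0) \<and> (\<forall>\<eta>\<in>RD. ip \<omega> \<eta> = 0)}"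
    using L by (auto simp: ran_delta_N ran_bdry_D)
next
  fix \<omega> assume "\<omega> \<in> {\<omega> \<in> L. (\<forall>\<eta>\<in>RN. ip \<omega> \<eta> = 0) \<and> (\<forall>\<eta>\<in>RD. ip \<omega> \<eta> = 0)}"
  then show "\<omega> \<in> harm"
    using orthogonal_range_coboundary[of \<omega>] orthogonal_range_boundary[of \<omega>] fin_subset_dom_bdry
    by (auto simp: op_ker_Laplacian ran_delta_N ran_bdry_D)
qed

lemma harm_subset: "harm \<subseteq> L"
  by (auto simp: op_ker_Laplacian_orthogonal)

lemma linear_subspace_harm: "linear_subspace harm"
  unfolding linear_subspace_def op_ker_Laplacian_orthogonal
  using subsetD[OF ran_delta_N_subset] subsetD[OF ran_bdry_D_subset]
  by (auto simp: l2_zero l2_add l2_scale inner_emb[symmetric] emb_zero emb_add emb_scale inner_add_left)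

text \<open>\<open>\<delta> \<alpha>\<close> is itself in the domain of
  \<open>\<delta>\<^sub>N\<close>, its coboundary being 0, so \<open>green\<close> trades the
  boundary of \<open>\<phi>\<close> for \<open>\<delta> (\<delta> \<alpha>)\<close>.\<close>

lemma ranges_orthogonal:
  assumes "\<omega> \<in> RN" "\<eta> \<in> RD"
  shows "ip \<omega> \<eta> = 0"
proof -
  obtain \<alpha> \<phi> where \<alpha>: "\<alpha> \<in> dom_cobd" "\<omega> = \<delta> \<alpha>" and \<phi>: "\<phi> \<in> dom_bdry" "\<eta> = bd \<phi>"
    using assms by (auto simp: ran_delta_N ran_bdry_D)
  have "ip \<omega> \<eta> = ip (\<delta> (\<delta> \<alpha>)) \<phi>"
    using green[OF coboundary_dom_cobd[OF \<alpha>(1)] \<phi>(1)] \<alpha> \<phi> by simp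
  then show ?thesis
    using \<alpha> by (simp add: dom_cobd_D(1) coboundary_coboundary l2_cochain l2_inner_zero)
qed

lemma l2_orthogonal_closures:
  assumes "A \<subseteq> L" "B \<subseteq> L" and orth: "\<And>\<omega> \<eta>. \<omega> \<in> A \<Longrightarrow> \<eta> \<in> B \<Longrightarrow> ip \<omega> \<eta> = 0"
  shows "l2_orthogonal K m (l2_closure K m A) (l2_closure K m B)"
proof -
  have "ip \<omega> \<eta> = 0" if \<omega>: "\<omega> \<in> l2_closure K m A" and \<eta>: "\<eta> \<in> l2_closure K m B" for \<omega> \<eta>
  proof -
    have "ip \<eta> a = 0" if "a \<in> A" for a
      using orthogonal_l2_closure[OF \<open>B \<subseteq> L\<close> _ _ \<eta>] orth that \<open>A \<subseteq> L\<close>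
      by (metis l2_inner_commute subsetD)
    then have "ip \<eta> \<omega> = 0"
      using orthogonal_l2_closure[OF \<open>A \<subseteq> L\<close> _ _ \<omega>] \<eta> l2_closure_subset[OF \<open>B \<subseteq> L\<close>] by blast
    then show ?thesis by (simp add: l2_inner_commute)
  qed
  then show ?thesis by (simp add: l2_orthogonal_def)
qed

text \<open>Project onto the closure of \<open>RN\<close>, then project the remainder onto the
  closure of \<open>RD\<close>. The second projection is itself orthogonal to \<open>RN\<close>, so
  removing it preserves the orthogonality gained first, and what is left is harmonic.\<close>

lemma hodge_decomposition:
  "L = harm + l2_closure K m RN + l2_closure K m RD"
proof (intro equalityI subsetI)
  fix \<omega> assume "\<omega> \<in> L"
  obtain p q where p: "p \<in> l2_closure K m RN" and q: "q \<in> L" and pq: "\<omega> = p + q"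
    and q_orth: "\<And>s. s \<in> RN \<Longrightarrow> ip q s = 0"
    using l2_projection[OF linear_subspace_ran_delta_N \<open>\<omega> \<in> L\<close>] by metis
  obtain p' h where p': "p' \<in> l2_closure K m RD" and h: "h \<in> L" and p'h: "q = p' + h"
    and h_orth: "\<And>s. s \<in> RD \<Longrightarrow> ip h s = 0"
    using l2_projection[OF linear_subspace_ran_bdry_D q] by metis
  have "p' \<in> L" using p' l2_closure_subset[OF ran_bdry_D_subset] by blast
  have "ip h s = 0" if "s \<in> RN" for s
  proof -
    have "s \<in> L" using that ran_delta_N_subset by blast
    have "ip s p' = 0"
      using orthogonal_l2_closure[OF ran_bdry_D_subset \<open>s \<in> L\<close> _ p'] ranges_orthogonal that by blast
    moreover have "ip q s = ip p' s + ip h s"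
      unfolding p'h using \<open>p' \<in> L\<close> h \<open>s \<in> L\<close> by (rule l2_inner_add_left)
    ultimately show ?thesis using q_orth[OF that] by (simp add: l2_inner_commute)
  qed
  then have "h \<in> harm" using h h_orth by (simp add: op_ker_Laplacian_orthogonal)
  moreover have "\<omega> = h + p + p'" unfolding pq p'h by (simp add: ac_simps)
  ultimately show "\<omega> \<in> harm + l2_closure K m RN + l2_closure K m RD"
    using p p' by (metis set_plus_intro)
next
  fix \<omega> assume "\<omega> \<in> harm + l2_closure K m RN + l2_closure K m RD"
  then show "\<omega> \<in> L"
    using harm_subset l2_closure_subset[OF ran_delta_N_subset] l2_closure_subset[OF ran_bdry_D_subset]
    by (auto simp: set_plus_def intro!: l2_add)
qed

section \<open>Fixed dimension and reduced cohomology\<close>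

abbreviation harm_dim where "harm_dim k \<equiv> op_ker (Laplacian_dim K m \<delta> k)"
abbreviation bnd where "bnd k \<equiv> reduced_bounds K m \<delta> k"

lemma op_ker_Laplacian_dim: "harm_dim k = harm \<inter> l2_dim K m k"
  by (auto simp: op_ker_def Laplacian_dim_def restrict_map_def)

lemma op_ker_delta_N_dim: "op_ker (delta_N_dim K m \<delta> k) = {\<omega> \<in> l2_dim K m k. \<delta> \<omega> = 0}"
  by (auto simp: op_ker_def delta_N_dim_def delta_N_eq restrict_map_def dom_cobd_def l2_dim_def l2_zero split: if_splits)

lemma ran_delta_N_dim: "ran (delta_N_dim K m \<delta> k) = \<delta> ` (dom_cobd \<inter> l2_dim K m k)"
  by (auto simp: delta_N_dim_def delta_N_eq restrict_map_def ran_def split: if_splits)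

definition trunc :: "int \<Rightarrow> 'v cochain \<Rightarrow> 'v cochain" where
  "trunc k \<omega> = (\<lambda>\<tau>. if simplex_dim \<tau> = k then \<omega> \<tau> else 0)"

lemma trunc_cochain: "\<omega> \<in> cochains K m \<Longrightarrow> trunc k \<omega> \<in> cochains K m"
  by (simp add: trunc_def cochains_def)

lemma trunc_l2: "\<omega> \<in> L \<Longrightarrow> trunc k \<omega> \<in> l2_dim K m k"
proof -
  assume \<omega>: "\<omega> \<in> L"
  then have "(\<lambda>\<tau>. (sqrt (m \<tau>) * \<omega> \<tau>)\<^sup>2) summable_on UNIV" by (simp add: l2_iff)
  then have "(\<lambda>\<tau>. (sqrt (m \<tau>) * trunc k \<omega> \<tau>)\<^sup>2) summable_on UNIV"
    by (rule summable_on_comparison_test) (auto simp: trunc_def)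
  then show ?thesis
    using trunc_cochain[OF l2_cochain[OF \<omega>]] by (auto simp: l2_dim_def l2_iff trunc_def split: if_splits)
qed

text \<open>All facets of \<open>\<sigma>\<close> have dimension one less than
  \<open>\<sigma>\<close>, so truncation keeps either every term of the sum for
  \<open>\<delta> \<omega> \<sigma>\<close> or none.\<close>

lemma coboundary_trunc:
  assumes "\<omega> \<in> cochains K m"
  shows "\<delta> (trunc (k - 1) \<omega>) = trunc k (\<delta> \<omega>)"
proof (rule cochain_eqI)
  fix \<sigma> assume \<sigma>: "\<sigma> \<in> X"
  have "(\<Sum>\<tau> | \<tau> \<in> X \<and> covers \<tau> \<sigma>. trunc (k - 1) \<omega> \<tau> * \<theta> \<tau> \<sigma>)
      = (\<Sum>\<tau> | \<tau> \<in> X \<and> covers \<tau> \<sigma>. if simplex_dim \<sigma> = k then \<omega> \<tau> * \<theta> \<tau> \<sigma> else 0)"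
    by (rule sum.cong) (auto simp: trunc_def covers_dim[OF \<sigma>])
  then show "\<delta> (trunc (k - 1) \<omega>) \<sigma> = trunc k (\<delta> \<omega>) \<sigma>"
    by (simp add: coboundary_apply[OF _ \<sigma>] trunc_cochain assms) (simp add: trunc_def coboundary_apply[OF assms \<sigma>])
qed (use assms in \<open>auto intro: trunc_cochain coboundary_cochain\<close>)

lemma l2_dim_eq: "l2_dim K m k = {\<omega> \<in> L. \<forall>\<tau>. simplex_dim \<tau> \<noteq> k \<longrightarrow> \<omega> \<tau> = 0}"
  unfolding l2_dim_def by blast

lemma linear_subspace_l2_dim: "linear_subspace (l2_dim K m k)"
  by (auto simp: linear_subspace_def l2_dim_eq l2_zero l2_add l2_scale)

lemma ran_delta_N_dim_subset:
  "ran (delta_N_dim K m \<delta> (k - 1)) \<subseteq> RN \<inter> l2_dim K m k"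
proof
  fix \<eta> assume "\<eta> \<in> ran (delta_N_dim K m \<delta> (k - 1))"
  then obtain \<omega> where \<omega>: "\<omega> \<in> dom_cobd" "\<omega> \<in> l2_dim K m (k - 1)" "\<eta> = \<delta> \<omega>"
    by (auto simp: ran_delta_N_dim)
  then have "trunc (k - 1) \<omega> = \<omega>" by (auto simp: trunc_def l2_dim_eq fun_eq_iff)
  then have "\<eta> = trunc k \<eta>"
    using \<omega> coboundary_trunc[OF l2_cochain[OF dom_cobd_D(1)[OF \<omega>(1)]], of k] by simp
  then show "\<eta> \<in> RN \<inter> l2_dim K m k"
    using \<omega> trunc_l2[OF dom_cobd_D(2)[OF \<omega>(1)], of k] by (auto simp: ran_delta_N)
qed

lemma linear_subspace_ran_delta_N_dim: "linear_subspace (ran (delta_N_dim K m \<delta> k))"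
proof -
  note dim = linear_subspaceD[OF linear_subspace_l2_dim[of k]]
  let ?D = "dom_cobd \<inter> l2_dim K m k"
  have "\<delta> \<omega> + \<delta> \<eta> \<in> \<delta> ` ?D" if "\<omega> \<in> ?D" "\<eta> \<in> ?D" for \<omega> \<eta>
  proof -
    have "\<delta> (\<omega> + \<eta>) = \<delta> \<omega> + \<delta> \<eta>"
      using that by (simp add: coboundary_add l2_cochain dom_cobd_D(1))
    then have "\<omega> + \<eta> \<in> ?D"
      using that dim(3) by (auto simp: dom_cobd_def l2_add)
    then show ?thesis
      by (rule rev_image_eqI) (simp add: \<open>\<delta> (\<omega> + \<eta>) = \<delta> \<omega> + \<delta> \<eta>\<close>)
  qed
  moreover have "(\<lambda>\<tau>. c * \<delta> \<omega> \<tau>) \<in> \<delta> ` ?D" if "\<omega> \<in> ?D" for \<omega> c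
  proof -
    have "\<delta> (\<lambda>\<tau>. c * \<omega> \<tau>) = (\<lambda>\<tau>. c * \<delta> \<omega> \<tau>)"
      using that by (simp add: coboundary_scale l2_cochain dom_cobd_D(1))
    then have "(\<lambda>\<tau>. c * \<omega> \<tau>) \<in> ?D"
      using that dim(4) by (auto simp: dom_cobd_def l2_scale)
    then show ?thesis
      by (rule rev_image_eqI) (simp add: \<open>\<delta> (\<lambda>\<tau>. c * \<omega> \<tau>) = (\<lambda>\<tau>. c * \<delta> \<omega> \<tau>)\<close>)
  qed
  moreover have "0 \<in> \<delta> ` ?D"
    using zero_dom_cobd dim(2) by (intro rev_image_eqI[of 0]) (simp_all add: coboundary_zero)
  moreover have "\<delta> ` ?D \<subseteq> L" by (auto simp: dom_cobd_D)
  ultimately show ?thesis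
    by (simp add: linear_subspace_def ran_delta_N_dim)
qed

lemma ran_delta_N_dim_l2: "ran (delta_N_dim K m \<delta> k) \<subseteq> L"
  by (rule linear_subspaceD(1)[OF linear_subspace_ran_delta_N_dim])

lemma linear_subspace_bounds: "linear_subspace (bnd k)"
  unfolding reduced_bounds_def
  by (rule linear_subspace_l2_closure[OF linear_subspace_ran_delta_N_dim])

lemma linear_subspace_harm_dim: "linear_subspace (harm_dim k)"
  using linear_subspace_harm linear_subspace_l2_dim[of k]
  by (simp add: linear_subspace_def op_ker_Laplacian_dim le_infI1)

lemma harm_orthogonal_bounds:
  assumes "h \<in> harm" "b \<in> bnd k"
  shows "ip h b = 0"
proof (rule orthogonal_l2_closure[OF ran_delta_N_dim_l2])
  show "b \<in> l2_closure K m (ran (delta_N_dim K m \<delta> (k - 1)))"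
    using assms(2) by (simp add: reduced_bounds_def)
  show "ip h s = 0" if "s \<in> ran (delta_N_dim K m \<delta> (k - 1))" for s
    using assms(1) subsetD[OF ran_delta_N_dim_subset that] by (simp add: op_ker_Laplacian_orthogonal)
  show "h \<in> L" using assms(1) harm_subset by blast
qed

text \<open>Both properties are orthogonality conditions, against indicators of faces of other
  dimensions and against boundaries of finite cochains; such conditions pass from the range to its
  closure.\<close>

lemma bounds_cocycle:
  assumes b: "b \<in> bnd k"
  shows "b \<in> l2_dim K m k" "\<delta> b = 0"
proof -
  have L: "b \<in> L" using b linear_subspaceD(1)[OF linear_subspace_bounds] by blast
  have orth: "ip \<eta> b = 0" if "\<eta> \<in> L" "\<And>s. s \<in> RN \<inter> l2_dim K m k \<Longrightarrow> ip \<eta> s = 0" for \<eta>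
    using orthogonal_l2_closure[OF ran_delta_N_dim_l2 that(1) _ b[unfolded reduced_bounds_def]]
      that(2)[OF subsetD[OF ran_delta_N_dim_subset]] .
  have "b \<sigma> = 0" if "simplex_dim \<sigma> \<noteq> k" for \<sigma>
  proof (cases "\<sigma> \<in> X")
    case True
    have "ip (indicator {\<sigma>}) b = 0"
    proof (rule orth)
      fix s assume "s \<in> RN \<inter> l2_dim K m k"
      then have "s \<sigma> = 0" using that by (auto simp: l2_dim_def)
      then show "ip (indicator {\<sigma>}) s = 0"
        by (simp add: l2_inner_commute[of "indicator {\<sigma>}"] l2_inner_indicator True)
    qed (use indicator_fin[OF True] fin_subset_l2 in auto)
    then show ?thesis
      using weight_pos[OF True] by (simp add: l2_inner_commute[of "indicator {\<sigma>}"] l2_inner_indicator True)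
  qed (simp add: cochain_zero[OF l2_cochain[OF L]])
  then show "b \<in> l2_dim K m k" using L by (auto simp: l2_dim_def)
  show "\<delta> b = 0"
  proof (rule orthogonal_range_boundary[OF L])
    fix \<phi> assume "\<phi> \<in> Fc"
    then have "bd \<phi> \<in> RD" "bd \<phi> \<in> L"
      using fin_subset_dom_bdry dom_bdry_D(2) by (auto simp: ran_bdry_D)
    then show "ip b (bd \<phi>) = 0"
      using orth[of "bd \<phi>"] ranges_orthogonal by (simp add: l2_inner_commute)
  qed
qed

text \<open>Projecting onto \<open>bnd k\<close> leaves a cocycle that is at first orthogonal only
  to the range coming from dimension \<open>k - 1\<close>; truncation extends this to all of
  \<open>RN\<close>, as harmonicity demands.\<close>

lemma cocycle_decomposition:
  assumes z: "z \<in> op_ker (delta_N_dim K m \<delta> k)"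
  obtains h b where "h \<in> harm_dim k" "b \<in> bnd k" "z = h + b"
proof -
  let ?R = "ran (delta_N_dim K m \<delta> (k - 1))"
  have z': "z \<in> l2_dim K m k" "\<delta> z = 0" using z by (auto simp: op_ker_delta_N_dim)
  then have "z \<in> L" by (simp add: l2_dim_def)
  then obtain b h where b: "b \<in> bnd k" and h: "h \<in> L" "z = b + h" and orth: "\<And>s. s \<in> ?R \<Longrightarrow> ip h s = 0"
    using l2_projection[OF linear_subspace_ran_delta_N_dim] unfolding reduced_bounds_def by metis
  note b' = bounds_cocycle[OF b]
  have "h = z - b" using h by simp
  then have hdim: "h \<in> l2_dim K m k"
    using z'(1) b'(1) linear_subspace_diff[OF linear_subspace_l2_dim] by blast
  have "\<delta> h = 0"
    using h z'(2) b' coboundary_add[of b h] by (simp add: l2_cochain l2_dim_def)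
  have "ip h (\<delta> \<alpha>) = 0" if "\<alpha> \<in> dom_cobd" for \<alpha>
  proof -
    have \<alpha>: "\<alpha> \<in> L" "\<delta> \<alpha> \<in> L" using dom_cobd_D that by auto
    \<comment> \<open>\<open>h\<close> sees only the part of \<open>\<delta> \<alpha>\<close> in
      dimension \<open>k\<close>, which is the coboundary of the part of \<open>\<alpha>\<close> in
      dimension \<open>k - 1\<close> and so lies in \<open>?R\<close>.\<close>
    have "trunc (k - 1) \<alpha> \<in> dom_cobd \<inter> l2_dim K m (k - 1)"
      using \<alpha> trunc_l2[OF \<alpha>(1), of "k - 1"] trunc_l2[OF \<alpha>(2), of k]
      by (simp add: dom_cobd_def coboundary_trunc l2_cochain l2_dim_def)
    then have "trunc k (\<delta> \<alpha>) \<in> ?R"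
      unfolding ran_delta_N_dim
      by (rule rev_image_eqI) (simp add: coboundary_trunc l2_cochain[OF \<alpha>(1)])
    moreover have "ip h (\<delta> \<alpha>) = ip h (trunc k (\<delta> \<alpha>))"
      unfolding l2_inner_def by (rule infsum_cong) (use hdim in \<open>auto simp: trunc_def l2_dim_eq\<close>)
    ultimately show ?thesis using orth by simp
  qed
  then have "h \<in> harm_dim k"
    using orthogonal_range_coboundary[OF h(1)] \<open>\<delta> h = 0\<close> hdim
    by (simp add: op_ker_Laplacian_dim op_ker_Laplacian)
  then show thesis using that b h(2) by (simp add: add.commute)
qed

section \<open>Cosets and their harmonic representatives\<close>

lemma mem_coset: "x \<in> h +o bnd k \<longleftrightarrow> x - h \<in> bnd k"
proof -
  have "x = h + b \<longleftrightarrow> b = x - h" for b by (auto simp: algebra_simps)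
  then show ?thesis by (simp add: elt_set_plus_def)
qed

lemma coset_bounds:
  assumes "b \<in> bnd k"
  shows "(h + b) +o bnd k = h +o bnd k"
proof -
  have "x - (h + b) \<in> bnd k \<longleftrightarrow> x - h \<in> bnd k" for x
    using linear_subspaceD(3)[OF linear_subspace_bounds _ assms, of "x - (h + b)"]
      linear_subspace_diff[OF linear_subspace_bounds _ assms, of "x - h"]
    by (auto simp: diff_diff_add)
  then show ?thesis by (auto simp: mem_coset)
qed

text \<open>By \<open>cocycle_decomposition\<close> a cocycle and its harmonic part lie in one
  coset; conversely, harmonic cochains are cocycles.\<close>

lemma reduced_cohomology_eq:
  "reduced_cohomology K m \<delta> k = (\<lambda>h. h +o bnd k) ` harm_dim k"
proof (intro equalityI subsetI)
  fix A assume "A \<in> reduced_cohomology K m \<delta> k"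
  then obtain z where z: "z \<in> op_ker (delta_N_dim K m \<delta> k)" "A = z +o bnd k"
    by (auto simp: reduced_cohomology_def)
  obtain h b where "h \<in> harm_dim k" "b \<in> bnd k" "z = h + b"
    using z(1) by (rule cocycle_decomposition)
  then show "A \<in> (\<lambda>h. h +o bnd k) ` harm_dim k"
    using z(2) by (simp add: coset_bounds)
next
  fix A assume "A \<in> (\<lambda>h. h +o bnd k) ` harm_dim k"
  then show "A \<in> reduced_cohomology K m \<delta> k"
    by (auto simp: reduced_cohomology_def op_ker_delta_N_dim op_ker_Laplacian_dim op_ker_Laplacian)
qed

text \<open>Two harmonic representatives of a class differ by a harmonic cochain that also lies in
  \<open>bnd k\<close>, hence is orthogonal to itself.\<close>

lemma inj_on_coset: "inj_on (\<lambda>h. h +o bnd k) (harm_dim k)"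
proof (rule inj_onI)
  fix h h' assume h: "h \<in> harm_dim k" "h' \<in> harm_dim k" and eq: "h +o bnd k = h' +o bnd k"
  have "h \<in> h +o bnd k"
    using linear_subspaceD(2)[OF linear_subspace_bounds] by (simp add: mem_coset)
  then have "h - h' \<in> bnd k" by (simp add: eq mem_coset)
  moreover have d: "h - h' \<in> harm_dim k"
    by (rule linear_subspace_diff[OF linear_subspace_harm_dim h])
  ultimately have "ip (h - h') (h - h') = 0"
    by (intro harm_orthogonal_bounds) (auto simp: op_ker_Laplacian_dim)
  then have "h - h' = 0"
    using d linear_subspaceD(1)[OF linear_subspace_harm_dim] l2_inner_self_eq_0 by blast
  then show "h = h'" by simp
qed

lemma coset_add: "(h +o bnd k) + (h' +o bnd k) = (h + h') +o bnd k"
proof (intro equalityI subsetI)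
  note B = linear_subspaceD[OF linear_subspace_bounds[of k]]
  fix x assume "x \<in> (h +o bnd k) + (h' +o bnd k)"
  then obtain u v where "u - h \<in> bnd k" "v - h' \<in> bnd k" and x: "x = u + v"
    by (auto simp: set_plus_def mem_coset)
  then have "(u - h) + (v - h') \<in> bnd k" by (intro B(3))
  then show "x \<in> (h + h') +o bnd k" by (simp add: mem_coset x algebra_simps)
next
  note B = linear_subspaceD[OF linear_subspace_bounds[of k]]
  fix x assume "x \<in> (h + h') +o bnd k"
  then have "x - h' \<in> h +o bnd k" by (simp add: mem_coset algebra_simps)
  moreover have "h' \<in> h' +o bnd k" using B(2) by (simp add: mem_coset)
  ultimately have "(x - h') + h' \<in> (h +o bnd k) + (h' +o bnd k)" by (rule set_plus_intro)
  then show "x \<in> (h +o bnd k) + (h' +o bnd k)" by simp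
qed

text \<open>The summand \<open>bnd k\<close> in \<open>quot_scale\<close> absorbs the remainder
  after scaling \<open>h\<close> itself, so the scalar 0 is covered together with the
  others.\<close>

lemma coset_scale: "quot_scale (bnd k) c (h +o bnd k) = (\<lambda>\<tau>. c * h \<tau>) +o bnd k"
proof (intro equalityI subsetI)
  note B = linear_subspaceD[OF linear_subspace_bounds[of k]]
  fix x assume "x \<in> quot_scale (bnd k) c (h +o bnd k)"
  then obtain u y where u: "u - h \<in> bnd k" and y: "y \<in> bnd k" and x: "x = (\<lambda>\<tau>. c * u \<tau>) + y"
    by (auto simp: quot_scale_def set_plus_def mem_coset)
  have "(\<lambda>\<tau>. c * (u - h) \<tau>) + y \<in> bnd k" by (intro B(3,4) u y)
  also have "(\<lambda>\<tau>. c * (u - h) \<tau>) + y = x - (\<lambda>\<tau>. c * h \<tau>)"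
    by (simp add: x fun_eq_iff algebra_simps)
  finally show "x \<in> (\<lambda>\<tau>. c * h \<tau>) +o bnd k" by (simp only: mem_coset)
next
  note B = linear_subspaceD[OF linear_subspace_bounds[of k]]
  fix x assume x: "x \<in> (\<lambda>\<tau>. c * h \<tau>) +o bnd k"
  have "h \<in> h +o bnd k" using B(2) by (simp add: mem_coset)
  then have "(\<lambda>\<tau>. c * h \<tau>) \<in> (\<lambda>\<omega> \<tau>. c * \<omega> \<tau>) ` (h +o bnd k)" by (rule imageI)
  moreover have "x - (\<lambda>\<tau>. c * h \<tau>) \<in> bnd k" using x by (simp only: mem_coset)
  ultimately have "(\<lambda>\<tau>. c * h \<tau>) + (x - (\<lambda>\<tau>. c * h \<tau>)) \<in> quot_scale (bnd k) c (h +o bnd k)"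
    unfolding quot_scale_def by (rule set_plus_intro)
  then show "x \<in> quot_scale (bnd k) c (h +o bnd k)" by simp
qed

text \<open>Pythagoras: \<open>h\<close> is orthogonal to \<open>bnd k\<close>, so no element of its
  coset is shorter, and \<open>h\<close> attains the infimum.\<close>

lemma coset_norm:
  assumes h: "h \<in> harm_dim k"
  shows "quot_norm K m (h +o bnd k) = l2_norm K m h"
  unfolding quot_norm_def
proof (rule cInf_eq_minimum)
  note B = linear_subspaceD[OF linear_subspace_bounds[of k]]
  have "h \<in> h +o bnd k" using B(2) by (simp add: mem_coset)
  then show "l2_norm K m h \<in> l2_norm K m ` (h +o bnd k)" by (rule imageI)
  fix x assume "x \<in> l2_norm K m ` (h +o bnd k)"
  then obtain u where u: "u - h \<in> bnd k" "x = l2_norm K m u"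
    by (auto simp: mem_coset)
  have h': "h \<in> L" "u - h \<in> L" "h \<in> harm"
    using subsetD[OF B(1) u(1)] h by (simp_all add: op_ker_Laplacian_dim l2_dim_def)
  have "u = h + (u - h)" by simp
  then have L: "u \<in> L" and emb_u: "emb u = emb h + emb (u - h)"
    using l2_add[OF h'(1,2)] emb_add[OF h'(1,2)] by simp_all
  have "inner (emb h) (emb (u - h)) = 0"
    using harm_orthogonal_bounds[OF h'(3) u(1)] h'(1,2) by (simp only: inner_emb)
  then have "(norm (emb u))\<^sup>2 = (norm (emb h))\<^sup>2 + (norm (emb (u - h)))\<^sup>2"
    unfolding emb_u by (simp add: dot_norm)
  then have "(norm (emb h))\<^sup>2 \<le> (norm (emb u))\<^sup>2" by simp
  then have "norm (emb h) \<le> norm (emb u)" by (rule power2_le_imp_le) simp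
  then show "l2_norm K m h \<le> x"
    by (simp only: u(2) norm_emb[OF L] norm_emb[OF h'(1)])
qed

lemma cohomology_iso_harmonic: "cohomology_iso K m \<delta> k (harm_dim k)"
proof -
  let ?C = "\<lambda>h. h +o bnd k"
  \<comment> \<open>The inverse of the coset map sends a class to its harmonic representative;
    linearity and isometry are then inherited from the coset map.\<close>
  define \<Phi> where "\<Phi> = inv_into (harm_dim k) ?C"
  have \<Phi>: "\<Phi> (?C h) = h" if "h \<in> harm_dim k" for h
    unfolding \<Phi>_def using inj_on_coset that by (rule inv_into_f_f)
  note H = linear_subspaceD[OF linear_subspace_harm_dim[of k]]
  have "bij_betw \<Phi> (?C ` harm_dim k) (harm_dim k)"
    unfolding \<Phi>_def by (intro bij_betw_inv_into inj_on_imp_bij_betw inj_on_coset)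
  moreover have "\<Phi> (?C h + ?C h') = \<Phi> (?C h) + \<Phi> (?C h')" if "h \<in> harm_dim k" "h' \<in> harm_dim k" for h h'
    using that H(3)[OF that] by (simp add: coset_add \<Phi>)
  moreover have "\<Phi> (quot_scale (bnd k) c (?C h)) = (\<lambda>\<tau>. c * \<Phi> (?C h) \<tau>)" if "h \<in> harm_dim k" for c h
    using that H(4)[OF that] by (simp add: coset_scale \<Phi>)
  moreover have "l2_norm K m (\<Phi> (?C h)) = quot_norm K m (?C h)" if "h \<in> harm_dim k" for h
    using that by (simp add: coset_norm \<Phi>)
  ultimately show ?thesis
    unfolding cohomology_iso_def reduced_cohomology_eq by (intro exI[of _ \<Phi>]) auto
qed

end

theorem theorem3p10:
  fixes V :: "'v set" and K :: "'v set set" and m :: "'v set \<Rightarrow> real"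
    and \<delta> :: "'v cochain \<Rightarrow> 'v cochain"
  assumes "abstract_simplicial_complex V K"
    and "weight K m"
    and "locally_summable K m"
    and "coboundary_operator K m \<delta>"
  shows "l2 K m = op_ker (Laplacian K m \<delta>) + l2_closure K m (ran (delta_N K m \<delta>))
           + l2_closure K m (ran (bdry_D K m \<delta>))
       \<and> l2_orthogonal K m (op_ker (Laplacian K m \<delta>)) (l2_closure K m (ran (delta_N K m \<delta>)))
       \<and> l2_orthogonal K m (op_ker (Laplacian K m \<delta>)) (l2_closure K m (ran (bdry_D K m \<delta>)))
       \<and> l2_orthogonal K m (l2_closure K m (ran (delta_N K m \<delta>)))
           (l2_closure K m (ran (bdry_D K m \<delta>)))
       \<and> (\<forall>k::int. k \<ge> 0 \<longrightarrow> cohomology_iso K m \<delta> k (op_ker (Laplacian_dim K m \<delta> k)))"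
proof -
  interpret weighted_complex V K m \<delta>
    by (rule weighted_complex.intro) (fact assms)+
  have "l2_orthogonal K m harm (l2_closure K m RN)"
    unfolding l2_orthogonal_def
    by (intro ballI, rule orthogonal_l2_closure[OF ran_delta_N_subset])
      (simp_all add: op_ker_Laplacian_orthogonal)
  moreover have "l2_orthogonal K m harm (l2_closure K m RD)"
    unfolding l2_orthogonal_def
    by (intro ballI, rule orthogonal_l2_closure[OF ran_bdry_D_subset])
      (simp_all add: op_ker_Laplacian_orthogonal)
  moreover have "l2_orthogonal K m (l2_closure K m RN) (l2_closure K m RD)"
    by (intro l2_orthogonal_closures ran_delta_N_subset ran_bdry_D_subset ranges_orthogonal)
  ultimately show ?thesis
    by (intro conjI allI impI hodge_decomposition cohomology_iso_harmonic)
qed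

end
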